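(* Let $T=(V,E)$ be an infinite, locally finite rooted tree with root $\rho$, let $p\in(0,1/2]$ and put $b=1-2p$. For each $k$ let $T_k=(V_k,E_k)$ be the subtree induced by the vertices within distance $k$ of $\rho$, let $\nu_k\in\mathrm{Prob}(\{0,1\}^{V_k})$ be the law of the Ising model on $T_k$ with flip probability $p$ (the depth-$k$ marginal of the Ising model on $T$), and let $\Delta_k=\Delta(T_k,b)$ be the $\ell^2(V_k)$-norm of the descendant generating function of $T_k$. If $\Delta_k\ne O(\sqrt{|V_k|})$ then the sequence $(\{0,1\}^{V_k},d,\nu_k)$, with $d$ the normalized Hamming metric, is not a normal Lévy family. In particular, it is not a normal Lévy family if $b^2\,\overline{\mathrm{gr}}\,T>1$; so if $\mathrm{maxgr}\,T=\overline{\mathrm{gr}}\,T$ there is a phase transition at this location: the sequence is a normal Lévy family if $b^2\,\overline{\mathrm{gr}}\,T<1$ and is not a normal Lévy family if $b^2\,\overline{\mathrm{gr}}\,T>1$.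
   Context: $\{0,1\}$ carries the discrete metric $d(0,1)=1$; for a finite set $V$, the normalized Hamming metric on $\{0,1\}^{V}$ is $d(x,y)=\frac1{|V|}\#\{v: x_v\ne y_v\}$. Ising model on a finite rooted tree with flip probability $p$: the law of $(X_v)_{v}$ with $X_\rho$ uniform on $\{0,1\}$ and, going from the root outward, $X_v$ equal to the value $X_{\pi(v)}$ at the parent $\pi(v)$ with probability $1-p$ and to the opposite value with probability $p$, independently over non-root vertices $v$. That is, $\nu(\{a\})=\frac12\prod_{v\ne\rho}P_{a_{\pi(v)}a_v}$ with $P_{00}=P_{11}=1-p$, $P_{01}=P_{10}=p$. Normal Lévy family: a sequence of metric probability spaces $(\mathscr{H}^{n_k},d_k,\mu_k)$ with $1\le n_1<n_2<\cdots$ is a normal Lévy family if there exist constants $c_1,c_2>0$ such that for all $\varepsilon>0$ and all $k$, $\sup\{\mu_k\{f>\varepsilon\}: f\ 1\text{-Lipschitz},\ \int f\,d\mu_k=0\}\le c_1e^{-c_2n_k\varepsilon^2}$. Here $\mathscr{H}=\{0,1\}$ and $n_k=|V_k|$. Trees: $d(v,w)$ is the graph distance; $v\le w$ means that $v$ lies on the simple path from $\rho$ to $w$ (endpoints included), and then $w$ is a descendant of $v$; $D_r(v)=\{w: v\le w,\ d(v,w)=r\}$. $\overline{\mathrm{gr}}\,T=\limsup_{r\to\infty}|D_r(\rho)|^{1/r}$ and $\mathrm{maxgr}\,T=\limsup_{r\to\infty}\max_{v\in V}|D_r(v)|^{1/r}$ (the maximum is read as a supremum; values in $[0,\infty]$,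 with $0\cdot\infty=0$). Descendant generating function of a finite rooted tree $T'=(V',E')$: $\delta(v)=\sum_{r=0}^\infty|D'_r(v)|\,b^r$ for $v\in V'$, where $D'_r(v)$ is the set of descendants of $v$ in $T'$ at distance $r$ from $v$ (with $b^0=1$, also when $b=0$), and $\Delta(T',b)=\big(\sum_{v\in V'}\delta(v)^2\big)^{1/2}$. *)

theory Defs
  imports "HOL-Probability.Probability" "HOL-Library.Landau_Symbols"
begin

section \<open>Rooted trees\<close>

text \<open>
  Edges are two-element sets of vertices. If an undirected edge were encoded as a pair of opposite
  arcs, every edge would give a directed cycle of length two, so the acyclicity notions available
  for digraphs cannot be used here.
\<close>

record 'a rooted_graph =
  verts :: "'a set"
  edges :: "'a set set"
  root_vertex :: 'a

definition walk :: "'a rooted_graph \<Rightarrow> 'a \<Rightarrow> 'a list \<Rightarrow> 'a \<Rightarrow> bool" where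
  "walk T u xs v \<longleftrightarrow> xs \<noteq> [] \<and> hd xs = u \<and> last xs = v \<and> set xs \<subseteq> verts T \<and>
     successively (\<lambda>x y. {x, y} \<in> edges T) xs"

definition simple_graph_path :: "'a rooted_graph \<Rightarrow> 'a \<Rightarrow> 'a list \<Rightarrow> 'a \<Rightarrow> bool" where
  "simple_graph_path T u xs v \<longleftrightarrow> walk T u xs v \<and> distinct xs"

definition connected_graph :: "'a rooted_graph \<Rightarrow> bool" where
  "connected_graph T \<longleftrightarrow> (\<forall>u\<in>verts T. \<forall>v\<in>verts T. \<exists>xs. walk T u xs v)"

text \<open>A cycle is a simple path on at least three vertices whose ends are adjacent.\<close>

definition acyclic_graph :: "'a rooted_graph \<Rightarrow> bool" where
  "acyclic_graph T \<longleftrightarrow>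
     \<not> (\<exists>u xs v. simple_graph_path T u xs v \<and> length xs \<ge> 3 \<and> {v, u} \<in> edges T)"

definition rooted_tree :: "'a rooted_graph \<Rightarrow> bool" where
  "rooted_tree T \<longleftrightarrow>
     root_vertex T \<in> verts T \<and>
     (\<forall>e\<in>edges T. \<exists>u\<in>verts T. \<exists>v\<in>verts T. u \<noteq> v \<and> e = {u, v}) \<and>
     connected_graph T \<and> acyclic_graph T"

definition locally_finite :: "'a rooted_graph \<Rightarrow> bool" where
  "locally_finite T \<longleftrightarrow> (\<forall>v\<in>verts T. finite {w \<in> verts T. {v, w} \<in> edges T})"

text \<open>A walk with \<open>n\<close> edges is a list of \<open>Suc n\<close> vertices.\<close>

definition graph_dist :: "'a rooted_graph \<Rightarrow> 'a \<Rightarrow> 'a \<Rightarrow> nat" where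
  "graph_dist T u v = (LEAST n. \<exists>xs. walk T u xs v \<and> length xs = Suc n)"

definition tree_le :: "'a rooted_graph \<Rightarrow> 'a \<Rightarrow> 'a \<Rightarrow> bool" where
  "tree_le T v w \<longleftrightarrow> (\<exists>xs. simple_graph_path T (root_vertex T) xs w \<and> v \<in> set xs)"

definition descendants_at :: "'a rooted_graph \<Rightarrow> nat \<Rightarrow> 'a \<Rightarrow> 'a set" where
  "descendants_at T r v = {w \<in> verts T. tree_le T v w \<and> graph_dist T v w = r}"

definition parent :: "'a rooted_graph \<Rightarrow> 'a \<Rightarrow> 'a" where
  "parent T v = (THE u. tree_le T u v \<and> graph_dist T u v = 1)"

definition truncation :: "'a rooted_graph \<Rightarrow> nat \<Rightarrow> 'a rooted_graph" where
  "truncation T k =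
     (let W = {v \<in> verts T. graph_dist T (root_vertex T) v \<le> k}
      in \<lparr>verts = W, edges = {e \<in> edges T. e \<subseteq> W}, root_vertex = root_vertex T\<rparr>)"

definition upper_growth :: "'a rooted_graph \<Rightarrow> ereal" where
  "upper_growth T =
     limsup (\<lambda>r. ereal (real (card (descendants_at T r (root_vertex T))) powr (1 / real r)))"

definition max_growth :: "'a rooted_graph \<Rightarrow> ereal" where
  "max_growth T =
     limsup (\<lambda>r. SUP v\<in>verts T. ereal (real (card (descendants_at T r v)) powr (1 / real r)))"

text \<open>For a finite tree only finitely many terms of the series are nonzero.\<close>

definition desc_gen_fun :: "'a rooted_graph \<Rightarrow> real \<Rightarrow> 'a \<Rightarrow> real" where
  "desc_gen_fun T b v = (\<Sum>r. real (card (descendants_at T r v)) * b ^ r)"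

definition desc_gen_norm :: "'a rooted_graph \<Rightarrow> real \<Rightarrow> real" where
  "desc_gen_norm T b = sqrt (\<Sum>v\<in>verts T. (desc_gen_fun T b v)\<^sup>2)"


section \<open>The Ising model on a finite rooted tree\<close>

text \<open>
  The configuration space \<open>{0, 1}\<^sup>V\<close> is the set \<open>V \<rightarrow>\<^sub>E {0, 1}\<close> of extensional functions.
\<close>

definition hamming_dist :: "'a set \<Rightarrow> ('a \<Rightarrow> nat) \<Rightarrow> ('a \<Rightarrow> nat) \<Rightarrow> real" where
  "hamming_dist V x y = real (card {v \<in> V. x v \<noteq> y v}) / real (card V)"

definition flip_kernel :: "real \<Rightarrow> nat \<Rightarrow> nat \<Rightarrow> real" where
  "flip_kernel p i j = (if i = j then 1 - p else p)"

definition ising_mass :: "'a rooted_graph \<Rightarrow> real \<Rightarrow> ('a \<Rightarrow> nat) \<Rightarrow> real" where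
  "ising_mass T p a =
     1 / 2 * (\<Prod>v\<in>verts T - {root_vertex T}. flip_kernel p (a (parent T v)) (a v))"

definition ising_measure :: "'a rooted_graph \<Rightarrow> real \<Rightarrow> ('a \<Rightarrow> nat) measure" where
  "ising_measure T p = point_measure (verts T \<rightarrow>\<^sub>E {0, 1}) (\<lambda>a. ennreal (ising_mass T p a))"


section \<open>Normal Levy families\<close>

text \<open>
  The carrier of the \<open>k\<close>-th metric probability space is \<open>space (\<mu> k)\<close>, and its measure lives on the
  Borel sets of the metric topology.
\<close>

locale metric_prob_sequence =
  fixes n :: "nat \<Rightarrow> nat" and d :: "nat \<Rightarrow> 'b \<Rightarrow> 'b \<Rightarrow> real" and \<mu> :: "nat \<Rightarrow> 'b measure"
  assumes n_pos: "1 \<le> n k"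
    and n_strict_mono: "strict_mono n"
    and metric: "Metric_space (space (\<mu> k)) (d k)"
    and borel: "sets (\<mu> k) =
      sigma_sets (space (\<mu> k)) {U. openin (Metric_space.mtopology (space (\<mu> k)) (d k)) U}"
    and prob: "prob_space (\<mu> k)"
begin

definition centred_lipschitz :: "nat \<Rightarrow> ('b \<Rightarrow> real) set" where
  "centred_lipschitz k =
     {f. (\<forall>x\<in>space (\<mu> k). \<forall>y\<in>space (\<mu> k). \<bar>f x - f y\<bar> \<le> d k x y) \<and>
         integrable (\<mu> k) f \<and> integral\<^sup>L (\<mu> k) f = 0}"

text \<open>
  The supremum is over a nonempty set (\<open>f = 0\<close> is admissible) of probabilities, so the real-valued
  supremum is the intended one.
\<close>

definition normal_levy_family :: bool where
  "normal_levy_family \<longleftrightarrow>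
     (\<exists>c1>0. \<exists>c2>0. \<forall>\<epsilon>>0. \<forall>k.
        (SUP f\<in>centred_lipschitz k. measure (\<mu> k) {x \<in> space (\<mu> k). f x > \<epsilon>})
          \<le> c1 * exp (- c2 * real (n k) * \<epsilon>\<^sup>2))"

end


section \<open>The Ising models on the truncations form a sequence of metric probability spaces\<close>

lemma walk_rev: "walk T u xs v \<Longrightarrow> walk T v (rev xs) u"
  by (auto simp: walk_def hd_rev last_rev insert_commute)

lemma walk_append:
  "walk T u xs v \<Longrightarrow> walk T v ys w \<Longrightarrow> walk T u (xs @ tl ys) w"
  by (cases ys) (auto simp: walk_def successively_append_iff successively_Cons)

lemma walk_prefix:
  assumes "walk T u xs v" "i < length xs"
  shows "walk T u (take (Suc i) xs) (xs ! i)"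
proof -
  have eq: "take (Suc i) xs = take i xs @ [xs ! i]"
    using assms by (simp add: take_Suc_conv_app_nth)
  have "successively (\<lambda>x y. {x, y} \<in> edges T) (take (Suc i) xs @ drop (Suc i) xs)"
    using assms by (simp add: walk_def)
  then have "successively (\<lambda>x y. {x, y} \<in> edges T) (take (Suc i) xs)"
    unfolding successively_append_iff by blast
  moreover have "hd (take (Suc i) xs) = u" "set (take (Suc i) xs) \<subseteq> verts T"
    using assms set_take_subset[of "Suc i" xs] by (auto simp: walk_def)
  ultimately show ?thesis using assms by (auto simp: walk_def eq)
qed

lemma graph_dist_le: "walk T u xs v \<Longrightarrow> graph_dist T u v \<le> length xs - 1"
  unfolding graph_dist_def
  by (rule Least_le) (auto simp: walk_def intro!: exI[of _ xs])

lemma graph_dist_attained: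
  assumes "walk T u xs v"
  shows "\<exists>ys. walk T u ys v \<and> length ys = Suc (graph_dist T u v)"
proof -
  have "\<exists>n. \<exists>xs. walk T u xs v \<and> length xs = Suc n"
    using assms by (intro exI[of _ "length xs - 1"] exI[of _ xs]) (auto simp: walk_def)
  from LeastI_ex[OF this] show ?thesis unfolding graph_dist_def .
qed

lemma graph_dist_refl: "u \<in> verts T \<Longrightarrow> graph_dist T u u = 0"
  using graph_dist_le[of T u "[u]" u] by (auto simp: walk_def)

lemma shortest_walk_nth:
  assumes "walk T u xs v" "length xs = Suc (graph_dist T u v)" "i < length xs"
  shows "graph_dist T u (xs ! i) = i"
proof (rule antisym)
  have w: "walk T u (take (Suc i) xs) (xs ! i)" by (rule walk_prefix[OF assms(1,3)])
  then show "graph_dist T u (xs ! i) \<le> i"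
    using graph_dist_le[OF w] assms(3) by simp
  obtain ys where ys: "walk T u ys (xs ! i)" "length ys = Suc (graph_dist T u (xs ! i))"
    using graph_dist_attained[OF w] by blast
  have "walk T (xs ! i) (drop i xs) v"
  proof -
    have "successively (\<lambda>x y. {x, y} \<in> edges T) (take i xs @ drop i xs)"
      using assms by (simp add: walk_def)
    then have "successively (\<lambda>x y. {x, y} \<in> edges T) (drop i xs)"
      unfolding successively_append_iff by blast
    moreover have "set (drop i xs) \<subseteq> verts T"
      using assms(1) set_drop_subset[of i xs] by (auto simp: walk_def)
    ultimately show ?thesis using assms(1,3)
      by (simp add: walk_def hd_drop_conv_nth)
  qed
  from graph_dist_le[OF walk_append[OF ys(1) this]]
  show "i \<le> graph_dist T u (xs ! i)" using assms ys by simp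
qed

lemma simple_graph_path_unique:
  assumes ac: "acyclic_graph T"
  shows "simple_graph_path T a xs b \<Longrightarrow> simple_graph_path T a ys b \<Longrightarrow> xs = ys"
proof (induction xs arbitrary: a ys)
  case Nil
  then show ?case by (simp add: simple_graph_path_def walk_def)
next
  case (Cons a' xs)
  then have [simp]: "a' = a" by (simp add: simple_graph_path_def walk_def)
  from Cons.prems obtain ys' where ys [simp]: "ys = a # ys'"
    by (cases ys) (auto simp: simple_graph_path_def walk_def)
  show ?case
  proof (cases "xs = [] \<or> ys' = []")
    case True
    then show ?thesis using Cons.prems
      by (auto simp: simple_graph_path_def walk_def split: if_splits)
  next
    case False
    note px = Cons.prems(1)[unfolded simple_graph_path_def walk_def]
    note py = Cons.prems(2)[unfolded simple_graph_path_def walk_def]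
    show ?thesis
    proof (cases "hd xs = hd ys'")
      case True
      have "simple_graph_path T (hd xs) xs b" "simple_graph_path T (hd xs) ys' b"
        using px py False True by (auto simp: simple_graph_path_def walk_def successively_Cons)
      from Cons.IH[OF this] show ?thesis by simp
    next
      case neq: False
      have "b = last xs" "b = last ys'" using px py False by (auto split: if_splits)
      then have "b \<in> set xs" "b \<in> set ys'" using False last_in_set by metis+
      then have "\<exists>x\<in>set xs. x \<in> set ys'" by blast
      from split_list_first_prop[OF this] obtain p z q where
        xs: "xs = p @ z # q" and z: "z \<in> set ys'" and p: "\<forall>y\<in>set p. y \<notin> set ys'" by blast
      from split_list[OF z] obtain r s where ys': "ys' = r @ z # s" by blast
      let ?c = "a # p @ [z] @ rev r"
      have len: "3 \<le> length ?c" using neq xs ys' by (cases p; cases r) auto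
      have last: "last ?c = hd ys'" using ys' by (cases r) auto
      have "successively (\<lambda>x y. {x, y} \<in> edges T) ((a # p @ [z]) @ q)"
        using px xs by simp
      then have s1: "successively (\<lambda>x y. {x, y} \<in> edges T) (a # p @ [z])"
        unfolding successively_append_iff by blast
      have "successively (\<lambda>x y. {x, y} \<in> edges T) ((r @ [z]) @ s)"
        using py ys' by (simp add: successively_Cons)
      then have "successively (\<lambda>x y. {x, y} \<in> edges T) (r @ [z])"
        unfolding successively_append_iff by blast
      then have "successively (\<lambda>x y. {x, y} \<in> edges T) (rev (r @ [z]))"
        by (subst successively_rev) (simp add: insert_commute)
      then have s2: "successively (\<lambda>x y. {x, y} \<in> edges T) (z # rev r)" by simp
      have "successively (\<lambda>x y. {x, y} \<in> edges T) ?c"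
        using s1 s2 by (cases r rule: rev_cases)
          (auto simp: successively_append_iff successively_Cons hd_append split: if_splits)
      moreover have "distinct ?c" "set ?c \<subseteq> verts T"
        using px py xs ys' p by auto
      ultimately have "simple_graph_path T a ?c (hd ys')"
        using last by (auto simp: simple_graph_path_def walk_def)
      moreover have "{hd ys', a} \<in> edges T"
        using py False by (auto simp: successively_Cons insert_commute)
      ultimately show ?thesis using ac len unfolding acyclic_graph_def by blast
    qed
  qed
qed

lemma walk_imp_simple_graph_path:
  assumes "walk T u xs v"
  shows "\<exists>ys. simple_graph_path T u ys v"
  using assms
proof (induction "length xs" arbitrary: xs rule: less_induct)
  case less
  show ?case
  proof (cases "distinct xs")
    case True
    then show ?thesis using less.prems by (auto simp: simple_graph_path_def)
  next
    case False
    then obtain as y bs cs where xs: "xs = as @ [y] @ bs @ [y] @ cs"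
      using not_distinct_decomp by blast
    have "walk T u (as @ [y] @ cs) v"
      using less.prems unfolding xs walk_def
      by (cases as) (auto simp: successively_append_iff successively_Cons hd_append split: if_splits)
    moreover have "length (as @ [y] @ cs) < length xs" by (simp add: xs)
    ultimately show ?thesis using less.hyps by blast
  qed
qed

lemma graph_dist_eq_1_iff:
  assumes "rooted_tree T" "u \<in> verts T" "v \<in> verts T"
  shows "graph_dist T u v = 1 \<longleftrightarrow> {u, v} \<in> edges T"
proof
  assume *: "graph_dist T u v = 1"
  obtain xs where "walk T u xs v"
    using assms unfolding rooted_tree_def connected_graph_def by blast
  then obtain ys where "walk T u ys v" "length ys = 2"
    using graph_dist_attained * by (metis One_nat_def Suc_1)
  then show "{u, v} \<in> edges T"
    by (cases ys; cases "tl ys") (auto simp: walk_def)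
next
  assume e: "{u, v} \<in> edges T"
  then have w: "walk T u [u, v] v" using assms by (auto simp: walk_def)
  have "u \<noteq> v" using e assms(1) unfolding rooted_tree_def by (metis insert_absorb2 doubleton_eq_iff)
  obtain ys where ys: "walk T u ys v" "length ys = Suc (graph_dist T u v)"
    using graph_dist_attained[OF w] by blast
  have "graph_dist T u v \<noteq> 0"
  proof
    assume "graph_dist T u v = 0"
    with ys obtain y where "ys = [y]" by (auto simp: length_Suc_conv)
    with ys \<open>u \<noteq> v\<close> show False by (auto simp: walk_def)
  qed
  with graph_dist_le[OF w] show "graph_dist T u v = 1" by simp
qed

lemma parent_simple_path:
  assumes T: "rooted_tree T" and xs: "simple_graph_path T (root_vertex T) (xs @ [u, v]) v"
  shows "parent T v = u"
  unfolding parent_def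
proof (rule the_equality)
  have uv: "u \<in> verts T" "v \<in> verts T" "{u, v} \<in> edges T"
    using xs by (auto simp: simple_graph_path_def walk_def successively_append_iff)
  show "tree_le T u v \<and> graph_dist T u v = 1"
    using uv xs T by (auto simp: graph_dist_eq_1_iff tree_le_def simp del: One_nat_def)
next
  fix w assume w: "tree_le T w v \<and> graph_dist T w v = 1"
  have ac: "acyclic_graph T" using T by (simp add: rooted_tree_def)
  from w obtain ys where "simple_graph_path T (root_vertex T) ys v" "w \<in> set ys"
    by (auto simp: tree_le_def)
  with simple_graph_path_unique[OF ac xs] have w_in: "w \<in> set (xs @ [u, v])" by auto
  with xs have V: "w \<in> verts T" "v \<in> verts T" by (auto simp: simple_graph_path_def walk_def)
  with w T have e: "{w, v} \<in> edges T" by (simp add: graph_dist_eq_1_iff del: One_nat_def)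
  then have "w \<noteq> v" using T unfolding rooted_tree_def by (metis insert_absorb2 doubleton_eq_iff)
  show "w = u"
  proof (rule ccontr)
    assume "w \<noteq> u"
    with w_in \<open>w \<noteq> v\<close> have "w \<in> set xs" by auto
    from split_list[OF this] obtain p q where pq: "xs = p @ w # q" by blast
    have "simple_graph_path T w (w # q @ [u, v]) v"
      using xs unfolding pq simple_graph_path_def walk_def by (auto simp: successively_append_iff)
    moreover have "3 \<le> length (w # q @ [u, v])" by simp
    moreover have "{v, w} \<in> edges T" using e by (simp add: insert_commute)
    ultimately show False using ac unfolding acyclic_graph_def by blast
  qed
qed

definition path_len :: "'a rooted_graph \<Rightarrow> 'a \<Rightarrow> nat" where
  "path_len T v = length (THE xs. simple_graph_path T (root_vertex T) xs v)"

lemma parent_rank: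
  assumes T: "rooted_tree T" and v: "v \<in> verts T" "v \<noteq> root_vertex T"
  shows "parent T v \<in> verts T" "path_len T (parent T v) < path_len T v"
proof -
  have ac: "acyclic_graph T" using T by (simp add: rooted_tree_def)
  obtain zs where "walk T (root_vertex T) zs v"
    using T v unfolding rooted_tree_def connected_graph_def by blast
  then obtain ys where ys: "simple_graph_path T (root_vertex T) ys v"
    using walk_imp_simple_graph_path[of T "root_vertex T" zs v] by auto
  obtain ws where ws: "ys = ws @ [v]"
    using ys by (cases ys rule: rev_cases) (auto simp: simple_graph_path_def walk_def)
  obtain xs u where xs: "ws = xs @ [u]"
    using ys v ws by (cases ws rule: rev_cases) (auto simp: simple_graph_path_def walk_def)
  have p: "simple_graph_path T (root_vertex T) (xs @ [u, v]) v" using ys ws xs by simp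
  have q: "simple_graph_path T (root_vertex T) (xs @ [u]) u"
    using p by (cases xs)
      (auto simp: simple_graph_path_def walk_def successively_append_iff successively_Cons
        hd_append split: if_splits)
  have par: "parent T v = u" using parent_simple_path[OF T p] .
  show "parent T v \<in> verts T" using p par by (auto simp: simple_graph_path_def walk_def)
  have "(THE xs. simple_graph_path T (root_vertex T) xs v) = xs @ [u, v]"
    using p simple_graph_path_unique[OF ac] by blast
  moreover have "(THE xs. simple_graph_path T (root_vertex T) xs u) = xs @ [u]"
    using q simple_graph_path_unique[OF ac] by blast
  ultimately show "path_len T (parent T v) < path_len T v"
    by (simp add: par path_len_def)
qed

lemma sum_tree_kernel:
  fixes par :: "'a \<Rightarrow> 'a" and rank :: "'a \<Rightarrow> nat"
  assumes "finite W" "r \<in> W"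
    and "\<And>v. v \<in> W \<Longrightarrow> v \<noteq> r \<Longrightarrow> par v \<in> W \<and> rank (par v) < rank v"
  shows "(\<Sum>a\<in>W \<rightarrow>\<^sub>E {0, 1}. \<Prod>v\<in>W - {r}. flip_kernel p (a (par v)) (a v)) = 2"
  using assms
proof (induction "card W" arbitrary: W rule: less_induct)
  case less
  show ?case
  proof (cases "W = {r}")
    case True
    have "card ({r} \<rightarrow>\<^sub>E {0, 1::nat}) = 2" by (simp add: card_PiE)
    then show ?thesis by (simp add: True)
  next
    case False
    have fin: "finite (W - {r})" and ne: "W - {r} \<noteq> {}" using False less.prems by auto
    have "Max (rank ` (W - {r})) \<in> rank ` (W - {r})" using fin ne by simp
    then obtain w where "w \<in> W - {r}" and w_Max: "rank w = Max (rank ` (W - {r}))" by fastforce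
    then have w: "w \<in> W" "w \<noteq> r" and w_max: "\<And>v. v \<in> W - {r} \<Longrightarrow> rank v \<le> rank w"
      using fin by auto
    define S where "S = W - {w}"
    have W: "W = insert w S" "w \<notin> S" using w by (auto simp: S_def)
    have r: "r \<in> S" "finite S" using w less.prems by (auto simp: S_def)
    have closed: "par v \<in> S" if "v \<in> W" "v \<noteq> r" for v
      using less.prems(3)[OF that] w_max[of v] that by (auto simp: S_def)
    have IH: "(\<Sum>a\<in>S \<rightarrow>\<^sub>E {0, 1}. \<Prod>v\<in>S - {r}. flip_kernel p (a (par v)) (a v)) = 2"
    proof (rule less.hyps)
      show "card S < card W" using r W by simp
      show "par v \<in> S \<and> rank (par v) < rank v" if "v \<in> S" "v \<noteq> r" for v
        using closed less.prems(3) that W by auto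
    qed (use r in auto)
    have eq: "(\<Prod>v\<in>W - {r}. flip_kernel p ((g(w := y)) (par v)) ((g(w := y)) v)) =
        flip_kernel p (g (par w)) y * (\<Prod>v\<in>S - {r}. flip_kernel p (g (par v)) (g v))" for g y
    proof -
      have 1: "W - {r} = insert w (S - {r})" using W w by auto
      have 2: "par w \<noteq> w" using closed[OF w] W by auto
      have 3: "(\<Prod>v\<in>S - {r}. flip_kernel p ((g(w := y)) (par v)) ((g(w := y)) v)) =
          (\<Prod>v\<in>S - {r}. flip_kernel p (g (par v)) (g v))"
      proof (rule prod.cong)
        fix v assume "v \<in> S - {r}"
        then have "v \<noteq> w" "par v \<noteq> w" using closed[of v] W by auto
        then show "flip_kernel p ((g(w := y)) (par v)) ((g(w := y)) v) =
          flip_kernel p (g (par v)) (g v)" by simp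
      qed simp
      show ?thesis unfolding 1 using r W 2 by (subst prod.insert) (simp_all add: 3 del: fun_upd_apply, simp)
    qed
    have "(\<Sum>a\<in>W \<rightarrow>\<^sub>E {0, 1}. \<Prod>v\<in>W - {r}. flip_kernel p (a (par v)) (a v)) =
        (\<Sum>(y, g)\<in>{0, 1} \<times> (S \<rightarrow>\<^sub>E {0, 1}).
           \<Prod>v\<in>W - {r}. flip_kernel p ((g(w := y)) (par v)) ((g(w := y)) v))"
    proof -
      have "W \<rightarrow>\<^sub>E {0, 1::nat} = (\<lambda>(y, g). g(w := y)) ` ({0, 1} \<times> (S \<rightarrow>\<^sub>E {0, 1}))"
        unfolding W(1) by (rule PiE_insert_eq)
      moreover have "inj_on (\<lambda>(y, g). g(w := y)) ({0, 1::nat} \<times> (S \<rightarrow>\<^sub>E {0, 1}))"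
        by (rule inj_combinator[OF W(2)])
      ultimately show ?thesis
        by (simp only: sum.reindex comp_def case_prod_unfold)
    qed
    also have "\<dots> = (\<Sum>(y, g)\<in>{0, 1} \<times> (S \<rightarrow>\<^sub>E {0, 1}).
        flip_kernel p (g (par w)) y * (\<Prod>v\<in>S - {r}. flip_kernel p (g (par v)) (g v)))"
      unfolding eq ..
    also have "\<dots> = (\<Sum>g\<in>S \<rightarrow>\<^sub>E {0, 1}. \<Sum>y\<in>{0, 1}.
        flip_kernel p (g (par w)) y * (\<Prod>v\<in>S - {r}. flip_kernel p (g (par v)) (g v)))"
      by (subst sum.cartesian_product [symmetric]) (rule sum.swap)
    also have "\<dots> = (\<Sum>g\<in>S \<rightarrow>\<^sub>E {0, 1}. \<Prod>v\<in>S - {r}. flip_kernel p (g (par v)) (g v))"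
    proof (rule sum.cong)
      fix g assume g: "g \<in> S \<rightarrow>\<^sub>E {0, 1::nat}"
      have "g (par w) \<in> {0, 1}" using g closed[OF w] by (auto simp: PiE_iff)
      then have "(\<Sum>y\<in>{0, 1}. flip_kernel p (g (par w)) y) = 1"
        by (auto simp: flip_kernel_def)
      then show "(\<Sum>y\<in>{0, 1}. flip_kernel p (g (par w)) y *
          (\<Prod>v\<in>S - {r}. flip_kernel p (g (par v)) (g v))) =
          (\<Prod>v\<in>S - {r}. flip_kernel p (g (par v)) (g v))"
        by (simp only: sum_distrib_right [symmetric] mult_1)
    qed simp
    finally show ?thesis using IH by simp
  qed
qed

lemma prob_space_ising_measure:
  assumes T: "rooted_tree T" and fin: "finite (verts T)" and p: "0 \<le> p" "p \<le> 1"
  shows "prob_space (ising_measure T p)"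
proof
  let ?\<Omega> = "verts T \<rightarrow>\<^sub>E {0, 1::nat}"
  have finO: "finite ?\<Omega>" using fin by (simp add: finite_PiE)
  have nn: "ising_mass T p a \<ge> 0" for a
    unfolding ising_mass_def flip_kernel_def using p
    by (intro mult_nonneg_nonneg prod_nonneg ballI) auto
  have "(\<Sum>a\<in>?\<Omega>. ising_mass T p a) = 1"
    using sum_tree_kernel[of "verts T" "root_vertex T" "parent T" "path_len T" p] fin T
      parent_rank[OF T]
    by (auto simp: ising_mass_def sum_divide_distrib [symmetric] rooted_tree_def)
  then have "(\<Sum>a\<in>?\<Omega>. ennreal (ising_mass T p a)) = 1"
    using nn by (simp add: sum_ennreal)
  then show "emeasure (ising_measure T p) (space (ising_measure T p)) = 1"
    unfolding ising_measure_def space_point_measure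
    by (subst emeasure_point_measure_finite[OF finO]) auto
qed

lemma Metric_space_hamming:
  assumes "finite V" "V \<noteq> {}"
  shows "Metric_space (V \<rightarrow>\<^sub>E {0, 1}) (hamming_dist V)"
proof
  fix x y z :: "'a \<Rightarrow> nat"
  show "0 \<le> hamming_dist V x y" by (simp add: hamming_dist_def)
  show "hamming_dist V x y = hamming_dist V y x"
    by (simp add: hamming_dist_def eq_commute)
  assume xy: "x \<in> V \<rightarrow>\<^sub>E {0, 1}" "y \<in> V \<rightarrow>\<^sub>E {0, 1}"
  have "card V \<noteq> 0" using assms by simp
  then have "hamming_dist V x y = 0 \<longleftrightarrow> {v \<in> V. x v \<noteq> y v} = {}"
    using assms by (simp add: hamming_dist_def)
  also have "\<dots> \<longleftrightarrow> x = y" using xy by (auto intro: PiE_ext)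
  finally show "hamming_dist V x y = 0 \<longleftrightarrow> x = y" .
next
  fix x y z :: "'a \<Rightarrow> nat"
  have "card {v \<in> V. x v \<noteq> z v} \<le> card ({v \<in> V. x v \<noteq> y v} \<union> {v \<in> V. y v \<noteq> z v})"
    using assms by (intro card_mono) auto
  also have "\<dots> \<le> card {v \<in> V. x v \<noteq> y v} + card {v \<in> V. y v \<noteq> z v}" by (rule card_Un_le)
  finally show "hamming_dist V x z \<le> hamming_dist V x y + hamming_dist V y z"
    by (simp add: hamming_dist_def add_divide_distrib [symmetric] divide_right_mono
        flip: of_nat_add)
qed

lemma borel_finite_metric:
  assumes "Metric_space M d" "finite M"
  shows "sigma_sets M {U. openin (Metric_space.mtopology M d) U} = Pow M"
proof -
  interpret Metric_space M d by fact
  have "openin mtopology U" if "U \<subseteq> M" for U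
  proof -
    have "finite (M - U)" using assms by simp
    then have "closedin mtopology (M - U)"
      by (intro closedin_Hausdorff_finite Hausdorff_space_mtopology) auto
    then show ?thesis using that by (simp add: openin_closedin_eq)
  qed
  then have "Pow M \<subseteq> {U. openin mtopology U}" by auto
  moreover have "sigma_sets M {U. openin mtopology U} \<subseteq> Pow M"
    using sigma_sets_into_sp[of "{U. openin mtopology U}" M] openin_subset[of mtopology] by auto
  ultimately show ?thesis by (auto intro: sigma_sets.Basic)
qed

lemma truncation_simps [simp]:
  "verts (truncation T k) = {v \<in> verts T. graph_dist T (root_vertex T) v \<le> k}"
  "edges (truncation T k) = {e \<in> edges T. e \<subseteq> {v \<in> verts T. graph_dist T (root_vertex T) v \<le> k}}"
  "root_vertex (truncation T k) = root_vertex T"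
  by (simp_all add: truncation_def Let_def)

lemma walk_truncation_iff:
  "walk (truncation T k) u xs v \<longleftrightarrow> walk T u xs v \<and> set xs \<subseteq> verts (truncation T k)"
proof -
  have "successively (\<lambda>x y. {x, y} \<in> edges (truncation T k)) xs \<longleftrightarrow>
      successively (\<lambda>x y. {x, y} \<in> edges T) xs" if "set xs \<subseteq> verts (truncation T k)"
    using that by (intro successively_cong) auto
  then show ?thesis by (auto simp: walk_def)
qed

lemma rooted_tree_shortest_walk:
  assumes "rooted_tree T" "v \<in> verts T"
  shows "\<exists>xs. walk T (root_vertex T) xs v \<and> length xs = Suc (graph_dist T (root_vertex T) v)"
proof -
  obtain zs where "walk T (root_vertex T) zs v"
    using assms unfolding rooted_tree_def connected_graph_def by blast
  then show ?thesis by (rule graph_dist_attained)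
qed

lemma rooted_tree_truncation:
  assumes T: "rooted_tree T"
  shows "rooted_tree (truncation T k)"
proof -
  let ?T = "truncation T k" and ?r = "root_vertex T"
  have r: "?r \<in> verts T" using T by (simp add: rooted_tree_def)
  have from_root: "\<exists>xs. walk ?T ?r xs v" if v: "v \<in> verts ?T" for v
  proof -
    obtain xs where xs: "walk T ?r xs v" "length xs = Suc (graph_dist T ?r v)"
      using rooted_tree_shortest_walk[OF T] v by auto
    have "set xs \<subseteq> verts ?T"
    proof
      fix y assume "y \<in> set xs"
      then obtain i where i: "i < length xs" "y = xs ! i" by (auto simp: in_set_conv_nth)
      then have "graph_dist T ?r y = i" using shortest_walk_nth[OF xs] by simp
      moreover have "y \<in> verts T" using xs \<open>y \<in> set xs\<close> by (auto simp: walk_def)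
      ultimately show "y \<in> verts ?T" using i xs v by simp
    qed
    then show ?thesis using xs by (auto simp: walk_truncation_iff)
  qed
  have "connected_graph ?T" unfolding connected_graph_def
    using from_root walk_rev walk_append by metis
  moreover have "acyclic_graph ?T"
    using T unfolding rooted_tree_def acyclic_graph_def simple_graph_path_def walk_truncation_iff by auto
  moreover have "\<forall>e\<in>edges ?T. \<exists>u\<in>verts ?T. \<exists>v\<in>verts ?T. u \<noteq> v \<and> e = {u, v}"
    using T unfolding rooted_tree_def by fastforce
  ultimately show ?thesis
    using r by (simp add: rooted_tree_def graph_dist_refl)
qed

lemma finite_truncation:
  assumes T: "rooted_tree T" and lf: "locally_finite T"
  shows "finite (verts (truncation T k))"
proof (induction k)
  let ?r = "root_vertex T"
  note reach = rooted_tree_shortest_walk[OF T]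
  case 0
  have "verts (truncation T 0) \<subseteq> {?r}"
  proof
    fix v assume "v \<in> verts (truncation T 0)"
    then have "v \<in> verts T" "graph_dist T ?r v = 0" by auto
    with reach[of v] obtain xs where "walk T ?r xs v" "length xs = Suc 0" by auto
    then show "v \<in> {?r}" by (cases xs) (auto simp: walk_def)
  qed
  then show ?case by (rule finite_subset) simp
next
  let ?r = "root_vertex T"
  note reach = rooted_tree_shortest_walk[OF T]
  case (Suc k)
  have sub: "verts (truncation T (Suc k)) \<subseteq> verts (truncation T k) \<union>
      (\<Union>u\<in>verts (truncation T k). {w \<in> verts T. {u, w} \<in> edges T})"
  proof
    fix v assume v: "v \<in> verts (truncation T (Suc k))"
    show "v \<in> verts (truncation T k) \<union>
      (\<Union>u\<in>verts (truncation T k). {w \<in> verts T. {u, w} \<in> edges T})"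
    proof (cases "graph_dist T ?r v \<le> k")
      case True
      then show ?thesis using v by simp
    next
      case False
      then have d: "graph_dist T ?r v = Suc k" and vT: "v \<in> verts T" using v by auto
      from reach[OF vT]
      obtain xs where xs: "walk T ?r xs v" "length xs = Suc (Suc k)" unfolding d by blast
      define u where "u = xs ! k"
      have "graph_dist T ?r u = k" using shortest_walk_nth[OF xs(1)] xs d by (simp add: u_def)
      moreover have "u \<in> verts T" using xs by (auto simp: walk_def u_def)
      moreover have "{u, xs ! Suc k} \<in> edges T"
        unfolding u_def using xs
          successively_nth[where P = "\<lambda>x y. {x, y} \<in> edges T" and xs = xs and i = k]
        by (simp add: walk_def)
      moreover have "xs ! Suc k = v"
        using xs by (auto simp: walk_def last_conv_nth)
      ultimately show ?thesis using vT by auto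
    qed
  qed
  have "finite {w \<in> verts T. {u, w} \<in> edges T}" if "u \<in> verts (truncation T k)" for u
    using lf that by (auto simp: locally_finite_def)
  then have fin: "finite (verts (truncation T k) \<union>
      (\<Union>u\<in>verts (truncation T k). {w \<in> verts T. {u, w} \<in> edges T}))"
    by (intro finite_UnI finite_UN_I Suc.IH)
  show ?case by (rule finite_subset[OF sub fin])
qed

lemma card_truncation_strict_mono:
  assumes T: "rooted_tree T" and inf: "infinite (verts T)" and lf: "locally_finite T"
  shows "strict_mono (\<lambda>k. card (verts (truncation T k)))"
  unfolding strict_mono_Suc_iff
proof
  fix k
  let ?r = "root_vertex T"
  have "\<not> verts T \<subseteq> verts (truncation T k)"
  proof
    assume "verts T \<subseteq> verts (truncation T k)"
    then have "finite (verts T)" by (rule finite_subset) (rule finite_truncation[OF T lf])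
    with inf show False by contradiction
  qed
  then obtain v where "v \<in> verts T" "v \<notin> verts (truncation T k)" by blast
  then have v: "v \<in> verts T" "graph_dist T ?r v > k" by auto
  then obtain xs where xs: "walk T ?r xs v" "length xs = Suc (graph_dist T ?r v)"
    using rooted_tree_shortest_walk[OF T] by blast
  have "graph_dist T ?r (xs ! Suc k) = Suc k" using shortest_walk_nth[OF xs] xs v by simp
  moreover have "xs ! Suc k \<in> verts T" using xs v by (auto simp: walk_def)
  ultimately have "xs ! Suc k \<in> verts (truncation T (Suc k)) - verts (truncation T k)" by simp
  then have "verts (truncation T k) \<subset> verts (truncation T (Suc k))" by auto
  then show "card (verts (truncation T k)) < card (verts (truncation T (Suc k)))"
    by (intro psubset_card_mono finite_truncation[OF T lf])
qed

theorem ising_metric_prob_sequence: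
  fixes T :: "'a rooted_graph"
  assumes T: "rooted_tree T" and inf: "infinite (verts T)" and lf: "locally_finite T"
    and p: "0 \<le> p" "p \<le> 1"
  shows "metric_prob_sequence (\<lambda>k. card (verts (truncation T k)))
    (\<lambda>k. hamming_dist (verts (truncation T k))) (\<lambda>k. ising_measure (truncation T k) p)"
proof (rule metric_prob_sequence.intro)
  fix k :: nat
  let ?V = "verts (truncation T k)"
  have fin: "finite ?V" by (rule finite_truncation[OF T lf])
  have "root_vertex (truncation T k) \<in> ?V"
    using rooted_tree_truncation[OF T] unfolding rooted_tree_def by (rule conjunct1)
  then have ne: "?V \<noteq> {}" by blast
  show "1 \<le> card ?V" using fin ne by (simp add: Suc_le_eq card_gt_0_iff del: truncation_simps)
  have sp: "space (ising_measure (truncation T k) p) = ?V \<rightarrow>\<^sub>E {0, 1}"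
    and st: "sets (ising_measure (truncation T k) p) = Pow (?V \<rightarrow>\<^sub>E {0, 1})"
    unfolding ising_measure_def space_point_measure sets_point_measure by simp_all
  show metric: "Metric_space (space (ising_measure (truncation T k) p)) (hamming_dist ?V)"
    unfolding sp by (rule Metric_space_hamming[OF fin ne])
  show "sets (ising_measure (truncation T k) p) = sigma_sets (space (ising_measure (truncation T k) p))
    {U. openin (Metric_space.mtopology (space (ising_measure (truncation T k) p)) (hamming_dist ?V)) U}"
    unfolding sp st
    by (rule borel_finite_metric[OF metric[unfolded sp], symmetric]) (simp add: finite_PiE fin
        del: truncation_simps)
  show "prob_space (ising_measure (truncation T k) p)"
    by (rule prob_space_ising_measure[OF rooted_tree_truncation[OF T] fin p])
qed (rule card_truncation_strict_mono[OF T inf lf])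

abbreviation ising_normal_levy_family :: "'a rooted_graph \<Rightarrow> real \<Rightarrow> bool" where
  "ising_normal_levy_family T p \<equiv>
     metric_prob_sequence.normal_levy_family (\<lambda>k. card (verts (truncation T k)))
       (\<lambda>k. hamming_dist (verts (truncation T k))) (\<lambda>k. ising_measure (truncation T k) p)"

end

theory Submission
  imports Defs
begin

text \<open>
  The sequence of Ising models turns out to be a normal Levy family exactly when the squared norms
  \<open>\<Delta>\<^sub>k\<^sup>2\<close> are bounded by a constant multiple of the number \<open>n\<^sub>k\<close> of vertices of the \<open>k\<close>-th
  truncation (\<open>ising_normal_levy_family_iff\<close>). The theorem follows by comparing \<open>\<Delta>\<^sub>k\<^sup>2\<close> with \<open>n\<^sub>k\<close>
  in terms of the growth of the tree.

  Both directions of the equivalence come from the same computation. Reveal the spins from the root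
  outwards. The innovation at a vertex \<open>v\<close> is \<open>\<sigma>\<^sub>v - b \<sigma>\<^bsub>\<pi>(v)\<^esub>\<close>, and its influence on the vertices
  below \<open>v\<close> decays by a factor \<open>b\<close> per generation, so that a unit weight on every vertex leads to
  a total weight \<open>\<delta>(v)\<close>, the descendant generating function. Formally, the last leaf is integrated
  out; this moves \<open>b\<close> times the weight of the leaf to its parent, and repeating it produces the
  recursion \<open>\<delta>(v) = 1 + b \<Sum> \<delta>(w)\<close> over the children \<open>w\<close> of \<open>v\<close>. For a Lipschitz function this
  bounds the martingale differences, and Hoeffding's lemma at each step gives subgaussian tails with
  variance proxy of order \<open>\<Delta>\<^sup>2 / n\<^sup>2\<close> (\<open>ising_exp_moment_le\<close>). For the magnetisation
  the differences are orthogonal with known variances, so that its variance is at least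
  \<open>(1 - b\<^sup>2) \<Delta>\<^sup>2 / (4 n\<^sup>2)\<close> (\<open>ising_linear_moments\<close>), whereas in a normal Levy family
  it must be of order \<open>1 / n\<close>.

  For the growth, the root alone contributes \<open>\<delta>(\<rho>) \<ge> b\<^sup>k n\<^sub>k\<close>, so that \<open>\<Delta>\<^sub>k\<^sup>2 \<le> C n\<^sub>k\<close> forces
  \<open>n\<^sub>k \<le> C b\<^bsup>-2k\<^esup>\<close> and hence an upper growth of at most \<open>1 / b\<^sup>2\<close>. Conversely, a maximal growth
  below \<open>1 / b\<^sup>2\<close> gives \<open>|D\<^sub>r(v)| b\<^bsup>2r\<^esup> \<le> C q\<^sup>r\<close> with \<open>q < 1\<close>, uniformly in \<open>v\<close>. As every vertex has
  at most one ancestor at distance \<open>r\<close>, the numbers \<open>|D\<^sub>r(v)|\<close> add up to at most \<open>n\<^sub>k\<close>, and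
  Minkowski's inequality bounds \<open>\<Delta>\<^sub>k\<close> by a geometric series times \<open>\<surd>n\<^sub>k\<close>.
\<close>

section \<open>Integrating out a leaf\<close>

definition children :: "'a \<Rightarrow> ('a \<Rightarrow> 'a) \<Rightarrow> 'a set \<Rightarrow> 'a \<Rightarrow> 'a set" where
  "children r par W v = {w \<in> W - {r}. par w = v}"

definition ising_mean ::
    "'a \<Rightarrow> ('a \<Rightarrow> 'a) \<Rightarrow> real \<Rightarrow> 'a set \<Rightarrow> (('a \<Rightarrow> nat) \<Rightarrow> real) \<Rightarrow> real" where
  "ising_mean r par p W f =
     (\<Sum>a\<in>W \<rightarrow>\<^sub>E {0, 1}. 1 / 2 * (\<Prod>v\<in>W - {r}. flip_kernel p (a (par v)) (a v)) * f a)"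

text \<open>
  A finite tree is given by its parent map alone, so that the vertex set can shrink in an induction
  while the map stays the same. The rank excludes cycles of the parent map.
\<close>

definition parent_tree :: "'a \<Rightarrow> ('a \<Rightarrow> 'a) \<Rightarrow> 'a set \<Rightarrow> bool" where
  "parent_tree r par W \<longleftrightarrow> finite W \<and> r \<in> W \<and>
     (\<exists>rank :: 'a \<Rightarrow> nat. \<forall>v\<in>W - {r}. par v \<in> W \<and> rank (par v) < rank v)"

definition leaf_extension :: "'a \<Rightarrow> ('a \<Rightarrow> 'a) \<Rightarrow> 'a set \<Rightarrow> 'a \<Rightarrow> bool" where
  "leaf_extension r par S w \<longleftrightarrow> parent_tree r par S \<and> w \<notin> S \<and> par w \<in> S"

text \<open>
  A vertex of maximal rank is nobody's parent, so it can be removed. This induction starts at the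
  root and attaches one leaf at a time.
\<close>

lemma leaf_induct [consumes 1, case_names root leaf]:
  assumes "parent_tree r par W"
    and root: "P {r}"
    and leaf: "\<And>S w. leaf_extension r par S w \<Longrightarrow> P S \<Longrightarrow> P (insert w S)"
  shows "P W"
  using assms(1)
proof (induction "card W" arbitrary: W rule: less_induct)
  case less
  show ?case
  proof (cases "W = {r}")
    case True
    then show ?thesis using root by simp
  next
    case False
    from less.prems have W: "finite W" "r \<in> W" by (auto simp: parent_tree_def)
    from less.prems obtain rank :: "'a \<Rightarrow> nat" where
      rank: "\<And>v. v \<in> W - {r} \<Longrightarrow> par v \<in> W \<and> rank (par v) < rank v"
      unfolding parent_tree_def by blast
    have fin: "finite (W - {r})" and ne: "W - {r} \<noteq> {}" using False W by auto
    have "Max (rank ` (W - {r})) \<in> rank ` (W - {r})" using fin ne by simp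
    then obtain w where "w \<in> W - {r}" and "rank w = Max (rank ` (W - {r}))" by fastforce
    then have w: "w \<in> W" "w \<noteq> r" and w_max: "\<And>v. v \<in> W - {r} \<Longrightarrow> rank v \<le> rank w"
      using fin by auto
    define S where "S = W - {w}"
    have ins: "W = insert w S" using w by (auto simp: S_def)
    have closed: "par v \<in> S" if "v \<in> W - {r}" for v
      using rank[OF that] w_max[OF that] by (auto simp: S_def)
    have S: "parent_tree r par S"
      unfolding parent_tree_def using W w closed rank
      by (intro conjI exI[of _ rank] ballI) (auto simp: S_def)
    have "P S"
      using W w by (intro less.hyps S) (simp only: S_def card_Diff1_less)
    moreover have "leaf_extension r par S w"
      using S w closed[of w] by (auto simp: leaf_extension_def S_def)
    ultimately show ?thesis using leaf ins by simp
  qed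
qed

lemma leaf_extensionD:
  assumes "leaf_extension r par S w"
  shows "finite S" "r \<in> S" "w \<notin> S" "par w \<in> S" "w \<noteq> r" "par w \<noteq> w"
    and "v \<in> S \<Longrightarrow> v \<noteq> r \<Longrightarrow> par v \<in> S"
  using assms by (auto simp: leaf_extension_def parent_tree_def)

lemma sum_PiE_insert:
  assumes "w \<notin> S"
  shows "(\<Sum>a\<in>insert w S \<rightarrow>\<^sub>E {0, 1::nat}. F a) =
    (\<Sum>g\<in>S \<rightarrow>\<^sub>E {0, 1}. \<Sum>y\<in>{0, 1}. F (g(w := y)))"
proof -
  have "insert w S \<rightarrow>\<^sub>E {0, 1::nat} = (\<lambda>(y, g). g(w := y)) ` ({0, 1} \<times> (S \<rightarrow>\<^sub>E {0, 1}))"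
    by (rule PiE_insert_eq)
  moreover have "inj_on (\<lambda>(y, g). g(w := y)) ({0, 1::nat} \<times> (S \<rightarrow>\<^sub>E {0, 1}))"
    by (rule inj_combinator[OF assms])
  ultimately have "(\<Sum>a\<in>insert w S \<rightarrow>\<^sub>E {0, 1::nat}. F a) =
      (\<Sum>(y, g)\<in>{0, 1} \<times> (S \<rightarrow>\<^sub>E {0, 1}). F (g(w := y)))"
    by (simp only: sum.reindex comp_def case_prod_unfold)
  also have "\<dots> = (\<Sum>g\<in>S \<rightarrow>\<^sub>E {0, 1}. \<Sum>y\<in>{0, 1}. F (g(w := y)))"
    by (subst sum.cartesian_product [symmetric]) (rule sum.swap)
  finally show ?thesis .
qed

text \<open>
  The root spin is uniform. Configurations are extensional, so the spins outside the vertex set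
  have the value \<open>undefined\<close>.
\<close>

lemma ising_mean_root:
  "ising_mean r par p {r} f = (\<Sum>y\<in>{0, 1}. 1 / 2 * f ((\<lambda>_. undefined)(r := y)))"
proof -
  have "ising_mean r par p {r} f = (\<Sum>a\<in>insert r {} \<rightarrow>\<^sub>E {0, 1::nat}. 1 / 2 * f a)"
    by (simp add: ising_mean_def)
  also have "\<dots> = (\<Sum>y\<in>{0, 1}. 1 / 2 * f ((\<lambda>_. undefined)(r := y)))"
    by (subst sum_PiE_insert) (simp_all del: fun_upd_apply)
  finally show ?thesis .
qed

text \<open>
  The factor of the leaf is the only one that involves its spin: integrating it out replaces
  \<open>f\<close> by its conditional expectation given the spins of the smaller tree.
\<close>

lemma ising_mean_insert:
  assumes gr: "leaf_extension r par S w"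
  shows "ising_mean r par p (insert w S) f =
    ising_mean r par p S (\<lambda>g. \<Sum>y\<in>{0, 1}. flip_kernel p (g (par w)) y * f (g(w := y)))"
proof -
  have w: "w \<notin> S" by (rule leaf_extensionD[OF gr])
  let ?K = "\<lambda>a v. flip_kernel p (a (par v)) (a v)"
  have eq: "(\<Prod>v\<in>insert w S - {r}. ?K (g(w := y)) v) =
      flip_kernel p (g (par w)) y * (\<Prod>v\<in>S - {r}. ?K g v)" for g y
  proof -
    have 1: "insert w S - {r} = insert w (S - {r})" using leaf_extensionD[OF gr] by auto
    have 2: "(\<Prod>v\<in>S - {r}. ?K (g(w := y)) v) = (\<Prod>v\<in>S - {r}. ?K g v)"
    proof (rule prod.cong)
      fix v assume "v \<in> S - {r}"
      then have "v \<noteq> w" "par v \<noteq> w" using leaf_extensionD[OF gr] by auto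
      then show "?K (g(w := y)) v = ?K g v" by simp
    qed simp
    show ?thesis unfolding 1 using leaf_extensionD[OF gr]
      by (subst prod.insert) (simp_all add: 2 del: fun_upd_apply, simp)
  qed
  show ?thesis
    unfolding ising_mean_def sum_PiE_insert[OF w] eq sum_distrib_left
    by (intro sum.cong refl) (simp add: mult_ac)
qed

lemma ising_mean_add:
  "ising_mean r par p W (\<lambda>a. f a + g a) = ising_mean r par p W f + ising_mean r par p W g"
  by (simp add: ising_mean_def sum.distrib [symmetric] distrib_left)

lemma ising_mean_cmult:
  "ising_mean r par p W (\<lambda>a. c * f a) = c * ising_mean r par p W f"
  by (simp add: ising_mean_def sum_distrib_left mult_ac)

lemma ising_mean_sum:
  "ising_mean r par p W (\<lambda>a. \<Sum>i\<in>I. f i a) = (\<Sum>i\<in>I. ising_mean r par p W (f i))"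
  unfolding ising_mean_def sum_distrib_left by (rule sum.swap)

lemma ising_mean_cong:
  "(\<And>a. a \<in> W \<rightarrow>\<^sub>E {0, 1} \<Longrightarrow> f a = g a) \<Longrightarrow> ising_mean r par p W f = ising_mean r par p W g"
  by (simp add: ising_mean_def)

lemma ising_mean_mono:
  assumes "0 \<le> p" "p \<le> 1" "\<And>a. a \<in> W \<rightarrow>\<^sub>E {0, 1} \<Longrightarrow> f a \<le> g a"
  shows "ising_mean r par p W f \<le> ising_mean r par p W g"
  unfolding ising_mean_def using assms
  by (intro sum_mono mult_left_mono mult_nonneg_nonneg prod_nonneg) (auto simp: flip_kernel_def)

lemma ising_mean_const:
  assumes "parent_tree r par W"
  shows "ising_mean r par p W (\<lambda>_. c) = c"
proof -
  from assms obtain rank :: "'a \<Rightarrow> nat" where "finite W" "r \<in> W"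
    "\<And>v. v \<in> W \<Longrightarrow> v \<noteq> r \<Longrightarrow> par v \<in> W \<and> rank (par v) < rank v"
    unfolding parent_tree_def by blast
  from sum_tree_kernel[OF this, of p] show ?thesis
    by (simp add: ising_mean_def sum_divide_distrib [symmetric] sum_distrib_right [symmetric])
qed

lemma children_insert:
  assumes gr: "leaf_extension r par S w"
  shows "children r par (insert w S) w = {}"
    and "v \<in> S \<Longrightarrow> children r par (insert w S) v =
      (if v = par w then insert w (children r par S v) else children r par S v)"
    and "v \<in> S \<Longrightarrow> finite (children r par S v) \<and> w \<notin> children r par S v"
  using leaf_extensionD[OF gr] by (auto simp: children_def)

text \<open>
  Attaching a leaf changes the recursion for \<open>\<delta>\<close> only at the parent of the leaf. This is the term
  that compensates for the weight moved from the leaf to its parent.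
\<close>

lemma sum_children_insert:
  fixes \<delta> :: "'a \<Rightarrow> real"
  assumes gr: "leaf_extension r par S w" and v: "v \<in> S"
  shows "sum \<delta> (children r par (insert w S) v) =
    sum \<delta> (children r par S v) + (if v = par w then \<delta> w else 0)"
  using children_insert(2,3)[OF gr v] by (cases "v = par w") (simp_all add: add.commute)

text \<open>
  Hoeffding's lemma for a variable with two values. For \<open>h = y - x \<ge> 0\<close> the left-hand side is
  \<open>exp (- h q) (1 + q (exp h - 1))\<close>, whose logarithm is at most \<open>h\<^sup>2 / 8\<close>.
\<close>

lemma two_point_exp_moment:
  fixes q x y :: real
  assumes q: "0 \<le> q" "q \<le> 1"
  defines "m \<equiv> (1 - q) * x + q * y"
  shows "(1 - q) * exp (x - m) + q * exp (y - m) \<le> exp ((y - x)\<^sup>2 / 8)"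
proof -
  have ordered: "(1 - q) * exp (x - m) + q * exp (y - m) \<le> exp ((y - x)\<^sup>2 / 8)"
    if q: "0 \<le> q" "q \<le> 1" and xy: "x \<le> y" and m: "m = (1 - q) * x + q * y" for q x y m :: real
  proof -
    define h where "h = y - x"
    have h: "h \<ge> 0" using xy by (simp add: h_def)
    have pos: "1 + q * (exp h - 1) > 0"
      using q h by (intro add_pos_nonneg mult_nonneg_nonneg) auto
    have "(1 - q) * exp (x - m) + q * exp (y - m) = exp (- h * q) * (1 + q * (exp h - 1))"
    proof -
      have "x - m = - h * q" "y - m = - h * q + h"
        by (simp_all add: m h_def algebra_simps)
      then show ?thesis by (simp only: exp_add) (simp add: algebra_simps)
    qed
    also have "\<dots> = exp (- h * q + ln (1 + q * (exp h - 1)))"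
      using pos by (simp only: exp_add exp_ln)
    also have "\<dots> \<le> exp (h\<^sup>2 / 8)"
      using Hoeffdings_lemma_aux[OF h q(1)] by simp
    finally show ?thesis by (simp add: h_def)
  qed
  show ?thesis
  proof (cases "x \<le> y")
    case True
    then show ?thesis using ordered[OF q] by (simp add: m_def)
  next
    case False
    then show ?thesis using ordered[of "1 - q" y x m] q
      by (simp add: m_def power2_commute add.commute)
  qed
qed

text \<open>
  This is the Azuma--Hoeffding bound for the martingale that reveals one spin at a time. Integrating
  out a leaf \<open>w\<close> costs a factor \<open>exp (c\<^sub>w\<^sup>2 / 8)\<close>. The conditional expectation has the same
  Lipschitz constants as \<open>f\<close> except at the parent of \<open>w\<close>, where flipping the parent also shifts
  the law of the leaf by \<open>1 - 2p\<close> in total variation, which adds \<open>(1 - 2p) c\<^sub>w\<close>.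
\<close>

lemma ising_exp_moment_le:
  fixes f :: "('a \<Rightarrow> nat) \<Rightarrow> real"
  assumes "parent_tree r par W"
    and p: "0 \<le> p" "p \<le> 1 / 2"
    and "\<And>v. v \<in> W \<Longrightarrow> 0 \<le> c v"
    and "\<And>a v y. a \<in> W \<rightarrow>\<^sub>E {0, 1} \<Longrightarrow> v \<in> W \<Longrightarrow> y \<in> {0, 1} \<Longrightarrow> \<bar>f (a(v := y)) - f a\<bar> \<le> c v"
    and "\<And>v. v \<in> W \<Longrightarrow> c v + (1 - 2 * p) * sum \<delta> (children r par W v) \<le> \<delta> v"
  shows "ising_mean r par p W (\<lambda>a. exp (f a - ising_mean r par p W f))
    \<le> exp ((\<Sum>v\<in>W. (\<delta> v)\<^sup>2) / 8)"
  using assms(1,4-)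
proof (induction W arbitrary: f c rule: leaf_induct)
  case root
  let ?x = "\<lambda>y. f ((\<lambda>_. undefined)(r := y))"
  have "\<bar>?x 1 - ?x 0\<bar> \<le> c r"
    using root(2)[of "(\<lambda>_. undefined)(r := 0)" r 1]
    by (simp add: PiE_iff extensional_def fun_upd_def if_distrib cong: if_cong)
  moreover have "c r \<le> \<delta> r" using root(3)[of r] by (auto simp: children_def)
  ultimately have "(?x 1 - ?x 0)\<^sup>2 \<le> (\<delta> r)\<^sup>2" by (intro power2_le_iff_abs_le[THEN iffD2]) auto
  moreover have "ising_mean r par p {r} (\<lambda>a. exp (f a - ising_mean r par p {r} f))
      \<le> exp ((?x 1 - ?x 0)\<^sup>2 / 8)"
    using two_point_exp_moment[of "1 / 2" "?x 0" "?x 1"] by (simp add: ising_mean_root)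
  ultimately show ?case by (auto elim!: order_trans)
next
  case (leaf S w)
  note gr = leaf.hyps
  let ?E = "ising_mean r par p" and ?K = "flip_kernel p"
  define u where "u = par w"
  have w: "w \<notin> S" "u \<in> S" "w \<noteq> u" "finite S" using leaf_extensionD(1-6)[OF gr] by (auto simp: u_def)
  define f' where "f' = (\<lambda>g. \<Sum>y\<in>{0, 1}. ?K (g u) y * f (g(w := y)))"
  define c' where "c' = c(u := c u + (1 - 2 * p) * c w)"
  define m where "m = ?E (insert w S) f"
  have m: "m = ?E S f'" unfolding m_def f'_def u_def by (rule ising_mean_insert[OF gr])
  have cw: "0 \<le> c w" "c w \<le> \<delta> w"
    using leaf.prems(1)[of w] leaf.prems(3)[of w] children_insert(1)[OF gr] by auto
  have ext: "a(w := y) \<in> insert w S \<rightarrow>\<^sub>E {0, 1}" if "a \<in> S \<rightarrow>\<^sub>E {0, 1}" "y \<in> {0, 1}"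
    for a and y :: nat
    using that by (auto simp: PiE_iff extensional_def)
  have lip_w: "\<bar>f (a(w := 1)) - f (a(w := 0))\<bar> \<le> c w" if "a \<in> S \<rightarrow>\<^sub>E {0, 1}" for a
    using leaf.prems(2)[OF ext[OF that, of 0], of w 1] by (simp del: fun_upd_apply)
  have lip_S: "\<bar>f (a(v := y, w := z)) - f (a(w := z))\<bar> \<le> c v"
    if "a \<in> S \<rightarrow>\<^sub>E {0, 1}" "v \<in> S" "y \<in> {0, 1}" "z \<in> {0, 1}" for a v y z
  proof -
    have "a(w := z, v := y) = a(v := y, w := z)" using that w by (intro fun_upd_twist) auto
    then show ?thesis using leaf.prems(2)[OF ext[OF that(1,4)], of v y] that by (simp del: fun_upd_apply)
  qed
  have IH: "?E S (\<lambda>a. exp (f' a - ?E S f')) \<le> exp ((\<Sum>v\<in>S. (\<delta> v)\<^sup>2) / 8)"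
  proof (rule leaf.IH)
    show "0 \<le> c' v" if "v \<in> S" for v
      using that leaf.prems(1) w p cw by (auto simp: c'_def)
    show "c' v + (1 - 2 * p) * sum \<delta> (children r par S v) \<le> \<delta> v" if v: "v \<in> S" for v
    proof -
      have "(1 - 2 * p) * c w \<le> (1 - 2 * p) * \<delta> w" using cw p by (intro mult_left_mono) auto
      then show ?thesis
        using leaf.prems(3)[of v] v sum_children_insert[OF gr v, of \<delta>]
        by (auto simp: c'_def u_def algebra_simps)
    qed
    show "\<bar>f' (a(v := y)) - f' a\<bar> \<le> c' v"
      if a: "a \<in> S \<rightarrow>\<^sub>E {0, 1}" and v: "v \<in> S" and y: "y \<in> {0, 1}" for a v y
    proof -
      let ?F = "\<lambda>z. f (a(w := z))" and ?G = "\<lambda>z. f (a(v := y, w := z))"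
      have GF: "\<bar>?G 0 - ?F 0\<bar> \<le> c v" "\<bar>?G 1 - ?F 1\<bar> \<le> c v"
        using lip_S[OF a v y] by auto
      have au: "a u \<in> {0, 1}" using a w by (auto simp: PiE_iff)
      have mix: "\<bar>(1 - q) * (?G 0 - ?F 0) + q * (?G 1 - ?F 1)\<bar> \<le> c v" if "0 \<le> q" "q \<le> 1" for q
      proof -
        have "\<bar>(1 - q) * (?G 0 - ?F 0) + q * (?G 1 - ?F 1)\<bar>
            \<le> (1 - q) * \<bar>?G 0 - ?F 0\<bar> + q * \<bar>?G 1 - ?F 1\<bar>"
          using that by (intro order_trans[OF abs_triangle_ineq]) (simp add: abs_mult)
        also have "\<dots> \<le> (1 - q) * c v + q * c v"
          using that GF by (intro add_mono mult_left_mono) auto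
        finally show ?thesis by (simp add: algebra_simps)
      qed
      show ?thesis
      proof (cases "v = u \<and> a u \<noteq> y")
        case False
        then have same: "(a(v := y)) u = a u" by auto
        have "f' (a(v := y)) - f' a = ?K (a u) 0 * (?G 0 - ?F 0) + ?K (a u) 1 * (?G 1 - ?F 1)"
          unfolding f'_def same by (simp add: algebra_simps)
        also have "?K (a u) 0 = 1 - ?K (a u) 1" using au by (auto simp: flip_kernel_def)
        finally have eq: "f' (a(v := y)) - f' a =
            (1 - ?K (a u) 1) * (?G 0 - ?F 0) + ?K (a u) 1 * (?G 1 - ?F 1)" .
        have "\<bar>f' (a(v := y)) - f' a\<bar> \<le> c v"
          unfolding eq by (rule mix) (use p in \<open>auto simp: flip_kernel_def\<close>)
        moreover have "c v \<le> c' v" using p cw by (auto simp: c'_def)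
        ultimately show ?thesis by simp
      next
        case True
        then have vu [simp]: "v = u" by simp
        let ?q = "?K y 1"
        \<comment> \<open>The first summand is the direct effect of flipping the parent, the second one the change of
          the law of the leaf.\<close>
        have "f' (a(v := y)) - f' a = ((1 - ?q) * (?G 0 - ?F 0) + ?q * (?G 1 - ?F 1)) +
            (2 * ?q - 1) * (?F 1 - ?F 0)"
          using True au y unfolding f'_def by (auto simp: flip_kernel_def algebra_simps)
        moreover have "\<bar>(2 * ?q - 1) * (?F 1 - ?F 0)\<bar> \<le> (1 - 2 * p) * c w"
          unfolding abs_mult using p lip_w[OF a] y
          by (intro mult_mono) (auto simp: flip_kernel_def)
        moreover have "\<bar>(1 - ?q) * (?G 0 - ?F 0) + ?q * (?G 1 - ?F 1)\<bar> \<le> c v"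
          by (rule mix) (use p in \<open>auto simp: flip_kernel_def\<close>)
        moreover have "c' v = c v + (1 - 2 * p) * c w" by (simp add: c'_def)
        ultimately show ?thesis by linarith
      qed
    qed
  qed
  have local_moment: "(\<Sum>y\<in>{0, 1}. ?K (g u) y * exp (f (g(w := y)) - m))
      \<le> exp (c w ^ 2 / 8) * exp (f' g - m)" if g: "g \<in> S \<rightarrow>\<^sub>E {0, 1}" for g
  proof -
    have gu: "g u \<in> {0, 1}" using g w by (auto simp: PiE_iff)
    let ?q = "?K (g u) 1" and ?F = "\<lambda>y. f (g(w := y))"
    have q: "0 \<le> ?q" "?q \<le> 1" and K0: "?K (g u) 0 = 1 - ?q"
      using gu p by (auto simp: flip_kernel_def)
    have f': "f' g = (1 - ?q) * ?F 0 + ?q * ?F 1" by (simp add: f'_def K0)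
    have "(\<Sum>y\<in>{0, 1}. ?K (g u) y * exp (?F y - m)) =
        ((1 - ?q) * exp (?F 0 - f' g) + ?q * exp (?F 1 - f' g)) * exp (f' g - m)"
      by (simp add: K0 distrib_right mult.assoc exp_add [symmetric])
    also have "\<dots> \<le> exp ((?F 1 - ?F 0)\<^sup>2 / 8) * exp (f' g - m)"
      unfolding f' by (intro mult_right_mono two_point_exp_moment q) auto
    also have "\<dots> \<le> exp (c w ^ 2 / 8) * exp (f' g - m)"
    proof -
      have "(?F 1 - ?F 0)\<^sup>2 \<le> (c w)\<^sup>2"
        using lip_w[OF g] by (intro power2_le_iff_abs_le[THEN iffD2] cw)
      then show ?thesis by simp
    qed
    finally show ?thesis .
  qed
  have "?E (insert w S) (\<lambda>a. exp (f a - m)) =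
      ?E S (\<lambda>g. \<Sum>y\<in>{0, 1}. ?K (g u) y * exp (f (g(w := y)) - m))"
    unfolding u_def by (rule ising_mean_insert[OF gr])
  also have "\<dots> \<le> ?E S (\<lambda>g. exp (c w ^ 2 / 8) * exp (f' g - m))"
    using p local_moment by (intro ising_mean_mono) auto
  also have "\<dots> \<le> exp (c w ^ 2 / 8) * exp ((\<Sum>v\<in>S. (\<delta> v)\<^sup>2) / 8)"
    unfolding ising_mean_cmult m by (intro mult_left_mono IH) auto
  also have "\<dots> \<le> exp ((\<delta> w)\<^sup>2 / 8) * exp ((\<Sum>v\<in>S. (\<delta> v)\<^sup>2) / 8)"
    using cw by (intro mult_right_mono) (auto intro: power_mono)
  also have "\<dots> = exp ((\<Sum>v\<in>insert w S. (\<delta> v)\<^sup>2) / 8)"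
    using w by (simp add: exp_add [symmetric] add_divide_distrib)
  finally show ?case unfolding m_def .
qed

text \<open>
  With this centring, the conditional expectation of a spin is \<open>1 - 2p\<close> times the spin of its
  parent.
\<close>

definition spin :: "nat \<Rightarrow> real" where
  "spin y = 1 - 2 * real y"

text \<open>
  With the weights moved to the parents, a linear functional becomes the sum over \<open>v\<close> of \<open>\<delta>\<^sub>v\<close>
  times the innovation at \<open>v\<close>. Innovations are orthogonal with variance \<open>1 - (1 - 2p)\<^sup>2\<close>, except at
  the root, where the variance is \<open>1\<close>; hence an inequality.
\<close>

lemma ising_linear_moments:
  fixes c :: "'a \<Rightarrow> real"
  assumes "parent_tree r par W"
    and p: "0 \<le> p" "p \<le> 1"
    and "\<And>v. v \<in> W \<Longrightarrow> \<delta> v = c v + (1 - 2 * p) * sum \<delta> (children r par W v)"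
  shows "ising_mean r par p W (\<lambda>a. \<Sum>v\<in>W. c v * spin (a v)) = 0 \<and>
    (1 - (1 - 2 * p)\<^sup>2) * (\<Sum>v\<in>W. (\<delta> v)\<^sup>2)
      \<le> ising_mean r par p W (\<lambda>a. (\<Sum>v\<in>W. c v * spin (a v))\<^sup>2)"
  using assms(1,4)
proof (induction W arbitrary: c rule: leaf_induct)
  case root
  have "\<delta> r = c r" using root[of r] by (auto simp: children_def)
  then show ?case by (simp add: ising_mean_root spin_def power_mult_distrib algebra_simps)
next
  case (leaf S w)
  note gr = leaf.hyps
  let ?E = "ising_mean r par p" and ?K = "flip_kernel p"
  define b where "b = 1 - 2 * p"
  define u where "u = par w"
  have w: "w \<notin> S" "u \<in> S" "w \<noteq> u" "finite S" using leaf_extensionD(1-6)[OF gr] by (auto simp: u_def)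
  have cw: "\<delta> w = c w" using leaf.prems[of w] children_insert(1)[OF gr] by simp
  define c' where "c' = c(u := c u + b * c w)"
  define X where "X = (\<lambda>a. \<Sum>v\<in>insert w S. c v * spin (a v))"
  define X' where "X' = (\<lambda>a. \<Sum>v\<in>S. c' v * spin (a v))"
  have IH: "?E S X' = 0" "(1 - b\<^sup>2) * (\<Sum>v\<in>S. (\<delta> v)\<^sup>2) \<le> ?E S (\<lambda>a. (X' a)\<^sup>2)"
  proof -
    have "\<delta> v = c' v + (1 - 2 * p) * sum \<delta> (children r par S v)" if v: "v \<in> S" for v
      using leaf.prems[of v] v sum_children_insert[OF gr v, of \<delta>] cw
      by (auto simp: c'_def u_def b_def algebra_simps)
    from leaf.IH[OF this] show "?E S X' = 0"
      "(1 - b\<^sup>2) * (\<Sum>v\<in>S. (\<delta> v)\<^sup>2) \<le> ?E S (\<lambda>a. (X' a)\<^sup>2)"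
      by (auto simp: X'_def b_def)
  qed
  \<comment> \<open>The last summand is the innovation at the leaf; it has mean zero given \<open>g\<close>.\<close>
  have split: "X (g(w := y)) = X' g + c w * (spin y - b * spin (g u))" for g y
  proof -
    have "X (g(w := y)) = c w * spin y + (\<Sum>v\<in>S. c v * spin ((g(w := y)) v))"
      using w by (simp add: X_def)
    also have "(\<Sum>v\<in>S. c v * spin ((g(w := y)) v)) = (\<Sum>v\<in>S. c v * spin (g v))"
      using w by (intro sum.cong) auto
    also have "X' g = (\<Sum>v\<in>S. c v * spin (g v) + (if v = u then b * c w * spin (g u) else 0))"
      unfolding X'_def by (intro sum.cong) (auto simp: c'_def algebra_simps)
    then have "(\<Sum>v\<in>S. c v * spin (g v)) = X' g - b * c w * spin (g u)"
      using w by (simp add: sum.distrib)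
    finally show ?thesis by (simp add: algebra_simps del: fun_upd_apply)
  qed
  have "?E (insert w S) X = ?E S (\<lambda>g. \<Sum>y\<in>{0, 1}. ?K (g u) y * X (g(w := y)))"
    unfolding u_def by (rule ising_mean_insert[OF gr])
  also have "\<dots> = ?E S X'"
  proof (rule ising_mean_cong)
    fix g assume "g \<in> S \<rightarrow>\<^sub>E {0, 1::nat}"
    then have "g u = 0 \<or> g u = 1" using w by (auto simp: PiE_iff)
    then show "(\<Sum>y\<in>{0, 1}. ?K (g u) y * X (g(w := y))) = X' g"
      unfolding split by (auto simp: flip_kernel_def spin_def b_def algebra_simps)
  qed
  finally have mean: "?E (insert w S) X = 0" using IH by simp
  have "?E (insert w S) (\<lambda>a. (X a)\<^sup>2) =
      ?E S (\<lambda>g. \<Sum>y\<in>{0, 1}. ?K (g u) y * (X (g(w := y)))\<^sup>2)"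
    unfolding u_def by (rule ising_mean_insert[OF gr])
  also have "\<dots> = ?E S (\<lambda>g. (X' g)\<^sup>2 + (1 - b\<^sup>2) * (\<delta> w)\<^sup>2)"
  proof (rule ising_mean_cong)
    fix g assume "g \<in> S \<rightarrow>\<^sub>E {0, 1::nat}"
    then have "g u = 0 \<or> g u = 1" using w by (auto simp: PiE_iff)
    then show "(\<Sum>y\<in>{0, 1}. ?K (g u) y * (X (g(w := y)))\<^sup>2) = (X' g)\<^sup>2 + (1 - b\<^sup>2) * (\<delta> w)\<^sup>2"
      unfolding split cw
      by (auto simp: flip_kernel_def spin_def b_def algebra_simps power2_eq_square)
  qed
  also have "\<dots> = ?E S (\<lambda>g. (X' g)\<^sup>2) + (1 - b\<^sup>2) * (\<delta> w)\<^sup>2"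
    using gr by (simp add: ising_mean_add ising_mean_const leaf_extension_def)
  finally have "?E (insert w S) (\<lambda>a. (X a)\<^sup>2) = ?E S (\<lambda>g. (X' g)\<^sup>2) + (1 - b\<^sup>2) * (\<delta> w)\<^sup>2" .
  moreover have "(1 - b\<^sup>2) * (\<Sum>v\<in>insert w S. (\<delta> v)\<^sup>2) =
      (1 - b\<^sup>2) * (\<Sum>v\<in>S. (\<delta> v)\<^sup>2) + (1 - b\<^sup>2) * (\<delta> w)\<^sup>2"
    using w by (simp add: distrib_left)
  ultimately have "(1 - b\<^sup>2) * (\<Sum>v\<in>insert w S. (\<delta> v)\<^sup>2) \<le> ?E (insert w S) (\<lambda>a. (X a)\<^sup>2)"
    using IH by linarith
  with mean show ?case unfolding X_def b_def by blast
qed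

section \<open>Descendants as iterated preimages under the parent map\<close>

abbreviation depth :: "'a rooted_graph \<Rightarrow> 'a \<Rightarrow> nat" where
  "depth T v \<equiv> graph_dist T (root_vertex T) v"

abbreviation tree_children :: "'a rooted_graph \<Rightarrow> 'a \<Rightarrow> 'a set" where
  "tree_children T \<equiv> children (root_vertex T) (parent T) (verts T)"

lemma simple_graph_path_prefix:
  "simple_graph_path T u xs v \<Longrightarrow> i < length xs \<Longrightarrow>
    simple_graph_path T u (take (Suc i) xs) (xs ! i)"
  by (auto simp: simple_graph_path_def intro: walk_prefix)

lemma simple_graph_path_suffix:
  assumes "simple_graph_path T u xs v" "i < length xs"
  shows "simple_graph_path T (xs ! i) (drop i xs) v"
proof -
  have "successively (\<lambda>x y. {x, y} \<in> edges T) (take i xs @ drop i xs)"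
    using assms by (simp add: simple_graph_path_def walk_def)
  then have "successively (\<lambda>x y. {x, y} \<in> edges T) (drop i xs)"
    unfolding successively_append_iff by blast
  then show ?thesis using assms set_drop_subset[of i xs]
    by (auto simp: simple_graph_path_def walk_def hd_drop_conv_nth)
qed

lemma simple_graph_path_exists:
  assumes "rooted_tree T" "u \<in> verts T" "v \<in> verts T"
  shows "\<exists>xs. simple_graph_path T u xs v"
  using assms walk_imp_simple_graph_path unfolding rooted_tree_def connected_graph_def by metis

text \<open>
  A shortest walk repeats no vertex, so it is the unique simple path. Distances can therefore be
  read off from any simple path.
\<close>

lemma length_simple_graph_path:
  assumes ac: "acyclic_graph T" and xs: "simple_graph_path T u xs v"
  shows "length xs = Suc (graph_dist T u v)"
proof -
  have "walk T u xs v" using xs by (simp add: simple_graph_path_def)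
  from graph_dist_attained[OF this] obtain ys where
    ys: "walk T u ys v" "length ys = Suc (graph_dist T u v)" by blast
  have "distinct ys"
    unfolding distinct_conv_nth using shortest_walk_nth[OF ys] by metis
  then have "ys = xs"
    using ys xs by (intro simple_graph_path_unique[OF ac]) (auto simp: simple_graph_path_def)
  then show ?thesis using ys by simp
qed

lemma simple_graph_path_in_verts:
  "simple_graph_path T u xs v \<Longrightarrow> i < length xs \<Longrightarrow> xs ! i \<in> verts T"
  by (auto simp: simple_graph_path_def walk_def)

lemma tree_le_iff_in_path:
  assumes "acyclic_graph T" "simple_graph_path T (root_vertex T) xs w"
  shows "tree_le T v w \<longleftrightarrow> v \<in> set xs"
  using assms(2) simple_graph_path_unique[OF assms] unfolding tree_le_def by blast

lemma parent_nth:
  assumes T: "rooted_tree T" and xs: "simple_graph_path T (root_vertex T) xs v"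
    and i: "Suc i < length xs"
  shows "parent T (xs ! Suc i) = xs ! i"
proof (rule parent_simple_path[OF T])
  have "take (Suc (Suc i)) xs = take i xs @ [xs ! i, xs ! Suc i]"
    using i by (simp add: take_Suc_conv_app_nth)
  then show "simple_graph_path T (root_vertex T) (take i xs @ [xs ! i, xs ! Suc i]) (xs ! Suc i)"
    using simple_graph_path_prefix[OF xs i] by simp
qed

lemma ancestor_nth:
  assumes T: "rooted_tree T" and xs: "simple_graph_path T (root_vertex T) xs v"
    and i: "i < length xs"
  shows "r \<le> i \<Longrightarrow> (parent T ^^ r) (xs ! i) = xs ! (i - r)"
proof (induction r)
  case (Suc r)
  then have "i - r = Suc (i - Suc r)" by simp
  then show ?case using Suc parent_nth[OF T xs, of "i - Suc r"] i by simp
qed simp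

text \<open>
  Going up from \<open>w\<close> along the parent map follows the simple path from the root backwards.
\<close>

lemma root_path:
  assumes T: "rooted_tree T" and w: "w \<in> verts T"
  obtains xs where "simple_graph_path T (root_vertex T) xs w" "length xs = Suc (depth T w)"
    "xs ! depth T w = w"
    "\<And>r. r \<le> depth T w \<Longrightarrow> (parent T ^^ r) w = xs ! (depth T w - r)"
proof -
  have ac: "acyclic_graph T" and root: "root_vertex T \<in> verts T"
    using T by (auto simp: rooted_tree_def)
  obtain xs where xs: "simple_graph_path T (root_vertex T) xs w"
    using simple_graph_path_exists[OF T root w] by blast
  have len: "length xs = Suc (depth T w)" by (rule length_simple_graph_path[OF ac xs])
  have "last xs = w" "xs \<noteq> []" using xs by (simp_all add: simple_graph_path_def walk_def)
  then have last: "xs ! depth T w = w" using len last_conv_nth[of xs] by simp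
  show thesis using that[OF xs len last] ancestor_nth[OF T xs, of "depth T w"] len last by simp
qed

lemma ancestor_depth:
  assumes T: "rooted_tree T" and w: "w \<in> verts T" and r: "r \<le> depth T w"
  shows "(parent T ^^ r) w \<in> verts T" "depth T ((parent T ^^ r) w) = depth T w - r"
proof -
  obtain xs where xs: "simple_graph_path T (root_vertex T) xs w" "length xs = Suc (depth T w)"
    "\<And>r. r \<le> depth T w \<Longrightarrow> (parent T ^^ r) w = xs ! (depth T w - r)"
    using root_path[OF T w] by metis
  have ac: "acyclic_graph T" using T by (simp add: rooted_tree_def)
  show "(parent T ^^ r) w \<in> verts T"
    using xs r simple_graph_path_in_verts[OF xs(1)] by simp
  show "depth T ((parent T ^^ r) w) = depth T w - r"
    using length_simple_graph_path[OF ac simple_graph_path_prefix[OF xs(1), of "depth T w - r"]]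
      xs r by simp
qed

lemma depth_eq_0_iff:
  assumes T: "rooted_tree T" and w: "w \<in> verts T"
  shows "depth T w = 0 \<longleftrightarrow> w = root_vertex T"
proof
  assume "depth T w = 0"
  moreover obtain xs where "simple_graph_path T (root_vertex T) xs w"
    "length xs = Suc (depth T w)" "xs ! depth T w = w"
    using root_path[OF T w] by metis
  ultimately show "w = root_vertex T"
    by (auto simp: simple_graph_path_def walk_def hd_conv_nth)
next
  assume "w = root_vertex T"
  then show "depth T w = 0" using w by (simp add: graph_dist_refl)
qed

text \<open>
  With this description a vertex has at most one ancestor at each distance, and the generations
  below \<open>v\<close> are obtained from those below its children. The condition on the depth is essential:
  beyond the root the parent map has no meaning.
\<close>

lemma descendants_at_eq:
  assumes T: "rooted_tree T"
  shows "descendants_at T r v = {w \<in> verts T. r \<le> depth T w \<and> (parent T ^^ r) w = v}"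
proof -
  have ac: "acyclic_graph T" using T by (simp add: rooted_tree_def)
  have "tree_le T v w \<and> graph_dist T v w = r \<longleftrightarrow> r \<le> depth T w \<and> (parent T ^^ r) w = v"
    if w: "w \<in> verts T" for w
  proof -
    obtain xs where xs: "simple_graph_path T (root_vertex T) xs w" "length xs = Suc (depth T w)"
      and anc: "\<And>r. r \<le> depth T w \<Longrightarrow> (parent T ^^ r) w = xs ! (depth T w - r)"
      using root_path[OF T w] by metis
    have le: "tree_le T v w \<longleftrightarrow> v \<in> set xs" by (rule tree_le_iff_in_path[OF ac xs(1)])
    have dist: "graph_dist T (xs ! i) w = depth T w - i" if "i \<le> depth T w" for i
      using length_simple_graph_path[OF ac simple_graph_path_suffix[OF xs(1), of i]] xs that
      by simp
    show ?thesis
    proof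
      assume l: "tree_le T v w \<and> graph_dist T v w = r"
      then obtain i where i: "i \<le> depth T w" "v = xs ! i"
        using xs le by (auto simp: in_set_conv_nth less_Suc_eq_le)
      then have "r = depth T w - i" using dist l by simp
      then show "r \<le> depth T w \<and> (parent T ^^ r) w = v" using anc i by simp
    next
      assume r: "r \<le> depth T w \<and> (parent T ^^ r) w = v"
      then have v: "v = xs ! (depth T w - r)" using anc[of r] by auto
      then have "v \<in> set xs" using xs by simp
      then show "tree_le T v w \<and> graph_dist T v w = r"
        using le v dist[of "depth T w - r"] r by simp
    qed
  qed
  then show ?thesis unfolding descendants_at_def by blast
qed

lemma descendants_at_0:
  "rooted_tree T \<Longrightarrow> v \<in> verts T \<Longrightarrow> descendants_at T 0 v = {v}"
  by (auto simp: descendants_at_eq)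

lemma descendants_at_Suc:
  assumes T: "rooted_tree T"
  shows "descendants_at T (Suc r) v = (\<Union>w\<in>tree_children T v. descendants_at T r w)"
proof (intro equalityI subsetI)
  fix x assume "x \<in> descendants_at T (Suc r) v"
  then have x: "x \<in> verts T" "Suc r \<le> depth T x" "parent T ((parent T ^^ r) x) = v"
    by (auto simp: descendants_at_eq[OF T])
  let ?w = "(parent T ^^ r) x"
  have w: "?w \<in> verts T" "depth T ?w = depth T x - r"
    using ancestor_depth[OF T x(1), of r] x by auto
  then have "?w \<noteq> root_vertex T" using depth_eq_0_iff[OF T w(1)] x by simp
  then have "?w \<in> tree_children T v" using w x by (auto simp: children_def)
  then show "x \<in> (\<Union>w\<in>tree_children T v. descendants_at T r w)"
    using x by (auto simp: descendants_at_eq[OF T])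
next
  fix x assume "x \<in> (\<Union>w\<in>tree_children T v. descendants_at T r w)"
  then obtain w where w: "w \<in> verts T" "w \<noteq> root_vertex T" "parent T w = v"
    and x: "x \<in> verts T" "r \<le> depth T x" "(parent T ^^ r) x = w"
    by (auto simp: children_def descendants_at_eq[OF T])
  have "depth T x \<noteq> r"
    using ancestor_depth(2)[OF T x(1,2)] x w depth_eq_0_iff[OF T w(1)] by auto
  then show "x \<in> descendants_at T (Suc r) v" using x w by (simp add: descendants_at_eq[OF T])
qed

lemma descendants_at_disjoint:
  assumes "rooted_tree T" "v \<noteq> w"
  shows "descendants_at T r v \<inter> descendants_at T r w = {}"
  using assms by (auto simp: descendants_at_eq)

lemma descendants_at_subset: "descendants_at T r v \<subseteq> verts T"
  by (auto simp: descendants_at_def)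

lemma card_descendants_at_Suc:
  assumes T: "rooted_tree T" and fin: "finite (verts T)"
  shows "card (descendants_at T (Suc r) v) =
    (\<Sum>w\<in>tree_children T v. card (descendants_at T r w))"
  unfolding descendants_at_Suc[OF T]
proof (rule card_UN_disjoint)
  show "finite (tree_children T v)" using fin by (simp add: children_def)
  show "\<forall>w\<in>tree_children T v. finite (descendants_at T r w)"
    using finite_subset[OF descendants_at_subset fin] by simp
qed (simp add: descendants_at_disjoint[OF T])

text \<open>
  The sets \<open>D\<^sub>r(v)\<close> are disjoint for fixed \<open>r\<close>, although they may be large for individual \<open>v\<close>.
\<close>

lemma sum_card_descendants_at_le:
  assumes T: "rooted_tree T" and fin: "finite (verts T)"
  shows "(\<Sum>v\<in>verts T. card (descendants_at T r v)) \<le> card (verts T)"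
proof -
  have "(\<Sum>v\<in>verts T. card (descendants_at T r v)) =
      card (\<Union>v\<in>verts T. descendants_at T r v)"
    using fin finite_subset[OF descendants_at_subset fin] descendants_at_disjoint[OF T]
    by (intro card_UN_disjoint [symmetric] ballI impI)
  also have "\<dots> \<le> card (verts T)"
    using fin by (intro card_mono UN_least descendants_at_subset)
  finally show ?thesis .
qed

lemma descendants_at_empty:
  assumes "rooted_tree T" "\<forall>w\<in>verts T. depth T w < r"
  shows "descendants_at T r v = {}"
  using assms by (auto simp: descendants_at_eq dest: leD)

lemma depth_bounded:
  assumes "finite (verts T)"
  obtains N where "\<forall>w\<in>verts T. depth T w < N"
proof
  show "\<forall>w\<in>verts T. depth T w < Suc (Max (depth T ` verts T))"
    using assms by (simp add: less_Suc_eq_le)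
qed

lemma desc_gen_fun_eq_sum:
  assumes T: "rooted_tree T" and N: "\<forall>w\<in>verts T. depth T w < N"
  shows "desc_gen_fun T b v = (\<Sum>r<N. real (card (descendants_at T r v)) * b ^ r)"
  unfolding desc_gen_fun_def
proof (rule suminf_finite)
  show "real (card (descendants_at T r v)) * b ^ r = 0" if "r \<notin> {..<N}" for r
    using descendants_at_empty[OF T, of r v] N that by fastforce
qed simp

text \<open>
  This identifies the descendant generating function as the weight that accumulates at \<open>v\<close> when
  the leaves of a tree with unit weights are integrated out one by one.
\<close>

lemma desc_gen_fun_recursion:
  assumes T: "rooted_tree T" and fin: "finite (verts T)" and v: "v \<in> verts T"
  shows "desc_gen_fun T b v = 1 + b * sum (desc_gen_fun T b) (tree_children T v)"
proof -
  obtain N where N: "\<forall>w\<in>verts T. depth T w < N"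
    using depth_bounded[OF fin] by blast
  then have N': "\<forall>w\<in>verts T. depth T w < Suc N" by fastforce
  have "desc_gen_fun T b v =
      1 + (\<Sum>r<N. real (card (descendants_at T (Suc r) v)) * b ^ Suc r)"
    unfolding desc_gen_fun_eq_sum[OF T N'] sum.lessThan_Suc_shift
    by (simp add: descendants_at_0[OF T v])
  also have "(\<Sum>r<N. real (card (descendants_at T (Suc r) v)) * b ^ Suc r) =
      (\<Sum>r<N. \<Sum>w\<in>tree_children T v. b * (real (card (descendants_at T r w)) * b ^ r))"
    by (intro sum.cong refl)
      (simp add: card_descendants_at_Suc[OF T fin] sum_distrib_right sum_distrib_left mult_ac)
  also have "\<dots> = b * sum (desc_gen_fun T b) (tree_children T v)"
    by (subst sum.swap) (simp add: desc_gen_fun_eq_sum[OF T N] sum_distrib_left [symmetric])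
  finally show ?thesis .
qed

text \<open>
  Every vertex is a descendant of the root and contributes \<open>b\<close> to the power of its depth.
\<close>

lemma desc_gen_fun_root_ge:
  assumes T: "rooted_tree T" and fin: "finite (verts T)" and b: "0 \<le> b" "b \<le> 1"
    and k: "\<And>w. w \<in> verts T \<Longrightarrow> depth T w \<le> k"
  shows "b ^ k * real (card (verts T)) \<le> desc_gen_fun T b (root_vertex T)"
proof -
  let ?D = "\<lambda>r. descendants_at T r (root_vertex T)"
  have "verts T \<subseteq> (\<Union>r<Suc k. ?D r)"
  proof
    fix w assume w: "w \<in> verts T"
    let ?a = "(parent T ^^ depth T w) w"
    have "?a \<in> verts T" "depth T ?a = 0" using ancestor_depth[OF T w, of "depth T w"] by auto
    then have "w \<in> ?D (depth T w)" using w depth_eq_0_iff[OF T] by (auto simp: descendants_at_eq[OF T])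
    then show "w \<in> (\<Union>r<Suc k. ?D r)" using k[OF w] by (auto simp: less_Suc_eq_le)
  qed
  then have "card (verts T) \<le> card (\<Union>r<Suc k. ?D r)"
    using finite_subset[OF descendants_at_subset fin] by (intro card_mono) auto
  also have "\<dots> \<le> (\<Sum>r<Suc k. card (?D r))" by (rule card_UN_le) simp
  finally have "real (card (verts T)) \<le> (\<Sum>r<Suc k. real (card (?D r)))"
    by (metis of_nat_le_iff of_nat_sum)
  then have "b ^ k * real (card (verts T)) \<le> (\<Sum>r<Suc k. b ^ k * real (card (?D r)))"
    unfolding sum_distrib_left [symmetric] using b by (intro mult_left_mono) auto
  also have "\<dots> \<le> (\<Sum>r<Suc k. real (card (?D r)) * b ^ r)"
  proof (rule sum_mono)
    fix r assume "r \<in> {..<Suc k}"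
    then have "b ^ k \<le> b ^ r" using b by (intro power_decreasing) auto
    then show "b ^ k * real (card (?D r)) \<le> real (card (?D r)) * b ^ r"
      by (subst mult.commute) (intro mult_left_mono, auto)
  qed
  also have "\<dots> = desc_gen_fun T b (root_vertex T)"
    using k by (intro desc_gen_fun_eq_sum [symmetric] T) (simp add: less_Suc_eq_le)
  finally show ?thesis .
qed

lemma L2_set_sum_le:
  "finite I \<Longrightarrow> L2_set (\<lambda>v. \<Sum>i\<in>I. f i v) A \<le> (\<Sum>i\<in>I. L2_set (f i) A)"
proof (induction I rule: finite_induct)
  case empty
  show ?case by (simp add: L2_set_0')
next
  case (insert i I)
  then show ?case
    using L2_set_triangle_ineq[of "f i" "\<lambda>v. \<Sum>i\<in>I. f i v" A] by simp
qed

text \<open>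
  By Minkowski's inequality it suffices to bound the \<open>\<ell>\<^sup>2\<close> norm of \<open>b\<^sup>r |D\<^sub>r(v)|\<close> for each \<open>r\<close>. In
  its square, one factor \<open>|D\<^sub>r(v)|\<close> is absorbed by the growth hypothesis and the other one sums to
  at most the number of vertices.
\<close>

lemma desc_gen_norm_le:
  assumes T: "rooted_tree T" and fin: "finite (verts T)" and b: "0 \<le> b"
    and q: "0 \<le> q" "q < 1" and C: "0 \<le> C"
    and growth: "\<And>v r. v \<in> verts T \<Longrightarrow>
      real (card (descendants_at T r v)) * (b\<^sup>2) ^ r \<le> C * q ^ r"
  shows "desc_gen_norm T b \<le> sqrt C / (1 - sqrt q) * sqrt (real (card (verts T)))"
proof -
  let ?n = "real (card (verts T))" and ?D = "\<lambda>r v. real (card (descendants_at T r v))"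
  obtain N where N: "\<forall>w\<in>verts T. depth T w < N"
    using depth_bounded[OF fin] by blast
  have level: "L2_set (\<lambda>v. ?D r v * b ^ r) (verts T) \<le> sqrt (C * ?n) * sqrt q ^ r" for r
  proof -
    have "(\<Sum>v\<in>verts T. (?D r v * b ^ r)\<^sup>2) \<le> (\<Sum>v\<in>verts T. C * q ^ r * ?D r v)"
    proof (rule sum_mono)
      fix v assume v: "v \<in> verts T"
      have "(?D r v * b ^ r)\<^sup>2 = (?D r v * (b\<^sup>2) ^ r) * ?D r v"
        by (simp add: power2_eq_square power_mult_distrib mult_ac)
      also have "\<dots> \<le> C * q ^ r * ?D r v" by (intro mult_right_mono growth v) auto
      finally show "(?D r v * b ^ r)\<^sup>2 \<le> C * q ^ r * ?D r v" .
    qed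
    also have "\<dots> = C * q ^ r * (\<Sum>v\<in>verts T. ?D r v)" by (rule sum_distrib_left [symmetric])
    also have "\<dots> \<le> C * q ^ r * ?n"
      using C q sum_card_descendants_at_le[OF T fin, of r]
      by (intro mult_left_mono) (metis of_nat_le_iff of_nat_sum, auto)
    finally have "L2_set (\<lambda>v. ?D r v * b ^ r) (verts T) \<le> sqrt (C * q ^ r * ?n)"
      by (simp add: L2_set_def)
    also have "\<dots> = sqrt (C * ?n) * sqrt q ^ r"
      by (simp add: real_sqrt_mult real_sqrt_power)
    finally show ?thesis .
  qed
  have sq: "0 \<le> sqrt q" "sqrt q < 1" using q by auto
  have "desc_gen_norm T b = L2_set (\<lambda>v. \<Sum>r<N. ?D r v * b ^ r) (verts T)"
    by (simp add: desc_gen_norm_def L2_set_def desc_gen_fun_eq_sum[OF T N])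
  also have "\<dots> \<le> (\<Sum>r<N. L2_set (\<lambda>v. ?D r v * b ^ r) (verts T))"
    by (rule L2_set_sum_le) simp
  also have "\<dots> \<le> (\<Sum>r<N. sqrt (C * ?n) * sqrt q ^ r)" by (intro sum_mono level)
  also have "\<dots> = sqrt (C * ?n) * (\<Sum>r<N. sqrt q ^ r)" by (rule sum_distrib_left [symmetric])
  also have "\<dots> \<le> sqrt (C * ?n) * (1 / (1 - sqrt q))"
  proof (intro mult_left_mono)
    have "(\<Sum>r<N. sqrt q ^ r) \<le> (\<Sum>r. sqrt q ^ r)"
      using sq by (intro sum_le_suminf) (auto intro: summable_geometric)
    then show "(\<Sum>r<N. sqrt q ^ r) \<le> 1 / (1 - sqrt q)"
      using sq by (simp add: suminf_geometric)
  qed (use C in auto)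
  finally show ?thesis by (simp add: real_sqrt_mult field_simps)
qed

lemma simple_graph_path_truncation:
  "simple_graph_path (truncation T k) u xs v \<Longrightarrow> simple_graph_path T u xs v"
  by (auto simp: simple_graph_path_def walk_truncation_iff)

text \<open>
  A truncation contains the path from the root to each of its vertices, so neither the order nor the
  relevant distances change.
\<close>

lemma descendants_at_truncation:
  assumes T: "rooted_tree T"
  shows "descendants_at (truncation T k) r v = descendants_at T r v \<inter> verts (truncation T k)"
proof -
  let ?T = "truncation T k"
  have T': "rooted_tree ?T" by (rule rooted_tree_truncation[OF T])
  have ac: "acyclic_graph T" "acyclic_graph ?T" using T T' by (simp_all add: rooted_tree_def)
  have root: "root_vertex T \<in> verts ?T" using T' unfolding rooted_tree_def by simp
  have "tree_le ?T v w \<and> graph_dist ?T v w = r \<longleftrightarrow> tree_le T v w \<and> graph_dist T v w = r"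
    if w: "w \<in> verts ?T" for w
  proof -
    obtain xs where xs: "simple_graph_path ?T (root_vertex T) xs w"
      using simple_graph_path_exists[OF T' root w] by blast
    then have xs': "simple_graph_path T (root_vertex T) xs w"
      by (rule simple_graph_path_truncation)
    have le: "tree_le ?T v w \<longleftrightarrow> v \<in> set xs" "tree_le T v w \<longleftrightarrow> v \<in> set xs"
      using tree_le_iff_in_path[OF ac(1) xs'] tree_le_iff_in_path[OF ac(2)] xs by simp_all
    moreover have "graph_dist ?T v w = graph_dist T v w" if "v \<in> set xs"
    proof -
      obtain i where i: "i < length xs" "v = xs ! i" using \<open>v \<in> set xs\<close> by (auto simp: in_set_conv_nth)
      have "simple_graph_path ?T v (drop i xs) w"
        using simple_graph_path_suffix[OF xs i(1)] i by simp
      from length_simple_graph_path[OF ac(2) this]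
        length_simple_graph_path[OF ac(1) simple_graph_path_truncation[OF this]]
      show ?thesis by simp
    qed
    ultimately show ?thesis by auto
  qed
  moreover have "verts ?T \<subseteq> verts T" by auto
  ultimately show ?thesis unfolding descendants_at_def by blast
qed

lemma depth_truncation:
  assumes T: "rooted_tree T" and w: "w \<in> verts (truncation T k)"
  shows "depth (truncation T k) w \<le> k"
proof -
  have "rooted_tree (truncation T k)" by (rule rooted_tree_truncation[OF T])
  then have "root_vertex T \<in> verts (truncation T k)" unfolding rooted_tree_def by simp
  then obtain xs where xs: "simple_graph_path (truncation T k) (root_vertex T) xs w"
    using simple_graph_path_exists[OF rooted_tree_truncation[OF T] _ w] by blast
  have "acyclic_graph T" "acyclic_graph (truncation T k)"
    using T rooted_tree_truncation[OF T] by (simp_all add: rooted_tree_def)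
  then have "depth (truncation T k) w = depth T w"
    using length_simple_graph_path[OF _ xs]
      length_simple_graph_path[OF _ simple_graph_path_truncation[OF xs]] by simp
  then show ?thesis using w by simp
qed

lemma finite_descendants_at:
  assumes T: "rooted_tree T" and lf: "locally_finite T"
  shows "finite (descendants_at T r v)"
proof (rule finite_subset)
  show "descendants_at T r v \<subseteq> verts (truncation T (depth T v + r))"
  proof
    fix w assume "w \<in> descendants_at T r v"
    then have w: "w \<in> verts T" "r \<le> depth T w" "(parent T ^^ r) w = v"
      by (auto simp: descendants_at_eq[OF T])
    then have "depth T v = depth T w - r" using ancestor_depth(2)[OF T w(1,2)] by simp
    then show "w \<in> verts (truncation T (depth T v + r))" using w by simp
  qed
qed (rule finite_truncation[OF T lf])

section \<open>Concentration and the descendant generating function\<close>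

abbreviation ising_expectation :: "'a rooted_graph \<Rightarrow> real \<Rightarrow> (('a \<Rightarrow> nat) \<Rightarrow> real) \<Rightarrow> real" where
  "ising_expectation T p \<equiv> ising_mean (root_vertex T) (parent T) p (verts T)"

lemma parent_tree_verts:
  assumes T: "rooted_tree T" and fin: "finite (verts T)"
  shows "parent_tree (root_vertex T) (parent T) (verts T)"
  unfolding parent_tree_def
proof (intro conjI exI ballI)
  show "root_vertex T \<in> verts T" using T by (simp add: rooted_tree_def)
  show "parent T v \<in> verts T" "path_len T (parent T v) < path_len T v"
    if "v \<in> verts T - {root_vertex T}" for v
    using parent_rank[OF T] that by auto
qed (rule fin)

lemma ising_mass_nonneg: "0 \<le> p \<Longrightarrow> p \<le> 1 \<Longrightarrow> 0 \<le> ising_mass T p a"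
  unfolding ising_mass_def flip_kernel_def
  by (intro mult_nonneg_nonneg prod_nonneg ballI) auto

lemma integral_ising_measure:
  assumes fin: "finite (verts T)" and p: "0 \<le> p" "p \<le> 1"
  shows "integral\<^sup>L (ising_measure T p) f = ising_expectation T p f"
  unfolding ising_measure_def using fin ising_mass_nonneg[OF p]
  by (subst lebesgue_integral_point_measure_finite)
    (simp_all add: finite_PiE ising_mean_def ising_mass_def)

lemma space_ising_measure: "space (ising_measure T p) = verts T \<rightarrow>\<^sub>E {0, 1}"
  by (simp add: ising_measure_def space_point_measure)

lemma measure_ising_measure:
  assumes fin: "finite (verts T)" and p: "0 \<le> p" "p \<le> 1"
  shows "measure (ising_measure T p) {x \<in> space (ising_measure T p). P x} =
    ising_expectation T p (\<lambda>a. of_bool (P a))"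
proof -
  let ?M = "ising_measure T p"
  have "measure ?M {x \<in> space ?M. P x} = integral\<^sup>L ?M (indicator {x \<in> space ?M. P x})"
    by (simp add: Int_absorb2 subset_iff)
  also have "\<dots> = ising_expectation T p (\<lambda>a. of_bool (P a))"
    unfolding integral_ising_measure[OF assms]
    by (rule ising_mean_cong) (simp add: space_ising_measure indicator_def)
  finally show ?thesis .
qed

text \<open>
  The tail condition of a normal Levy family for a single tree, stated for each admissible function
  instead of as a supremum.
\<close>

definition subgaussian_tails :: "'a rooted_graph \<Rightarrow> real \<Rightarrow> real \<Rightarrow> real \<Rightarrow> bool" where
  "subgaussian_tails T p c1 c2 \<longleftrightarrow> (\<forall>\<epsilon>>0. \<forall>f.
     (\<forall>x\<in>verts T \<rightarrow>\<^sub>E {0, 1}. \<forall>y\<in>verts T \<rightarrow>\<^sub>E {0, 1}. \<bar>f x - f y\<bar> \<le> hamming_dist (verts T) x y) \<longrightarrow>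
     ising_expectation T p f = 0 \<longrightarrow>
     measure (ising_measure T p) {x \<in> space (ising_measure T p). \<epsilon> < f x}
       \<le> c1 * exp (- c2 * real (card (verts T)) * \<epsilon>\<^sup>2))"

lemma desc_gen_norm_squared: "(desc_gen_norm T b)\<^sup>2 = (\<Sum>v\<in>verts T. (desc_gen_fun T b v)\<^sup>2)"
  by (simp add: desc_gen_norm_def sum_nonneg)

lemma hamming_dist_update_le:
  assumes "finite V"
  shows "hamming_dist V (a(v := y)) a \<le> 1 / real (card V)"
proof -
  have "card {w \<in> V. (a(v := y)) w \<noteq> a w} \<le> card {v}" by (intro card_mono) auto
  then show ?thesis unfolding hamming_dist_def by (intro divide_right_mono) auto
qed

text \<open>
  Chernoff's method: the bound \<open>exp (- t \<epsilon> + t\<^sup>2 C / (8 n))\<close>, with \<open>C\<close> bounding \<open>\<Delta>\<^sup>2 / n\<close>, is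
  smallest for \<open>t = 4 n \<epsilon> / C\<close>.
\<close>

lemma subgaussian_tails_of_norm_le:
  assumes T: "rooted_tree T" and fin: "finite (verts T)" and p: "0 \<le> p" "p \<le> 1 / 2"
    and C: "0 < C" and norm: "(desc_gen_norm T (1 - 2 * p))\<^sup>2 \<le> C * real (card (verts T))"
  shows "subgaussian_tails T p 1 (2 / C)"
  unfolding subgaussian_tails_def
proof (intro allI impI)
  fix \<epsilon> :: real and f :: "('a \<Rightarrow> nat) \<Rightarrow> real"
  assume \<epsilon>: "0 < \<epsilon>" and mean: "ising_expectation T p f = 0"
    and lip: "\<forall>x\<in>verts T \<rightarrow>\<^sub>E {0, 1}. \<forall>y\<in>verts T \<rightarrow>\<^sub>E {0, 1}. \<bar>f x - f y\<bar> \<le> hamming_dist (verts T) x y"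
  let ?E = "ising_expectation T p" and ?V = "verts T"
  define n where "n = real (card ?V)"
  define t where "t = 4 * n * \<epsilon> / C"
  have "root_vertex T \<in> ?V" using T by (simp add: rooted_tree_def)
  then have n: "0 < n" using fin by (auto simp: n_def card_gt_0_iff)
  then have t: "0 < t" using \<epsilon> C by (simp add: t_def)
  define \<delta> where "\<delta> v = t / n * desc_gen_fun T (1 - 2 * p) v" for v
  have mean_t: "?E (\<lambda>a. t * f a) = 0" by (simp add: ising_mean_cmult mean)
  have "?E (\<lambda>a. exp (t * f a - ?E (\<lambda>a. t * f a))) \<le> exp ((\<Sum>v\<in>?V. (\<delta> v)\<^sup>2) / 8)"
  proof (rule ising_exp_moment_le[OF parent_tree_verts[OF T fin] p, where c = "\<lambda>_. t / n"])
    show "0 \<le> t / n" using t n by simp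
    show "\<bar>t * f (a(v := y)) - t * f a\<bar> \<le> t / n"
      if "a \<in> ?V \<rightarrow>\<^sub>E {0, 1}" "v \<in> ?V" "y \<in> {0, 1}" for a v y
    proof -
      have "a(v := y) \<in> ?V \<rightarrow>\<^sub>E {0, 1}" using that by (auto simp: PiE_iff extensional_def)
      then have "\<bar>f (a(v := y)) - f a\<bar> \<le> 1 / n"
        using lip[THEN bspec, THEN bspec, of "a(v := y)" a] hamming_dist_update_le[OF fin, of a v y] that(1)
        unfolding n_def by linarith
      then have "t * \<bar>f (a(v := y)) - f a\<bar> \<le> t * (1 / n)" using t by (intro mult_left_mono) auto
      then show ?thesis using t by (simp add: abs_mult right_diff_distrib [symmetric] del: fun_upd_apply)
    qed
    show "t / n + (1 - 2 * p) * sum \<delta> (tree_children T v) \<le> \<delta> v" if "v \<in> ?V" for v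
      unfolding \<delta>_def desc_gen_fun_recursion[OF T fin that, of "1 - 2 * p"] sum_distrib_left [symmetric]
      by (simp only: distrib_left mult_1_right mult.left_commute order_refl)
  qed
  also have "(\<Sum>v\<in>?V. (\<delta> v)\<^sup>2) = (t / n)\<^sup>2 * (desc_gen_norm T (1 - 2 * p))\<^sup>2"
    by (simp only: \<delta>_def desc_gen_norm_squared power_mult_distrib sum_distrib_left)
  also have "exp ((t / n)\<^sup>2 * (desc_gen_norm T (1 - 2 * p))\<^sup>2 / 8) \<le> exp ((t / n)\<^sup>2 * (C * n) / 8)"
    using norm by (auto simp: n_def intro!: divide_right_mono mult_left_mono)
  also have "(t / n)\<^sup>2 * (C * n) / 8 = 2 * n * \<epsilon>\<^sup>2 / C"
    using n C by (simp add: t_def power2_eq_square field_simps)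
  finally have mgf: "?E (\<lambda>a. exp (t * f a)) \<le> exp (2 * n * \<epsilon>\<^sup>2 / C)" by (simp add: mean_t)
  have "?E (\<lambda>a. of_bool (\<epsilon> < f a)) \<le> ?E (\<lambda>a. exp (- t * \<epsilon>) * exp (t * f a))"
  proof (rule ising_mean_mono)
    fix a
    have "1 \<le> exp (t * f a - t * \<epsilon>)" if "\<epsilon> < f a" using that t by simp
    then show "of_bool (\<epsilon> < f a) \<le> exp (- t * \<epsilon>) * exp (t * f a)"
      by (auto simp: exp_add [symmetric])
  qed (use p in auto)
  also have "\<dots> \<le> exp (- t * \<epsilon>) * exp (2 * n * \<epsilon>\<^sup>2 / C)"
    unfolding ising_mean_cmult by (intro mult_left_mono mgf) auto
  also have "\<dots> = exp (- (2 / C) * n * \<epsilon>\<^sup>2)"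
    by (simp add: exp_add [symmetric] t_def power2_eq_square)
  finally show "measure (ising_measure T p) {x \<in> space (ising_measure T p). \<epsilon> < f x}
      \<le> 1 * exp (- (2 / C) * real (card ?V) * \<epsilon>\<^sup>2)"
    using measure_ising_measure[OF fin, of p] p by (simp add: n_def)
qed

text \<open>
  A discrete layer-cake formula: for an integer \<open>N\<close> the square \<open>N\<^sup>2\<close> is the sum of the first \<open>N\<close>
  odd numbers.
\<close>

lemma square_le_tail_sum:
  fixes t :: real
  assumes "0 \<le> t" "t \<le> real N"
  shows "t\<^sup>2 \<le> (\<Sum>j<N. (2 * real j + 1) * of_bool (real j < t))"
  using assms(2)
proof (induction N)
  case 0
  then show ?case using assms(1) by simp
next
  case (Suc N)
  show ?case
  proof (cases "t \<le> real N")
    case True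
    then show ?thesis using Suc.IH by simp
  next
    case False
    have "(\<Sum>j<Suc N. (2 * real j + 1) * of_bool (real j < t)) = (\<Sum>j<Suc N. 2 * real j + 1)"
      using False by (intro sum.cong) auto
    also have "\<dots> = (real (Suc N))\<^sup>2"
      by (induction N) (simp_all add: power2_eq_square algebra_simps)
    finally show ?thesis using Suc.prems assms(1) by (auto intro: power_mono)
  qed
qed

text \<open>
  Expanding the square by its tails leaves the sum of \<open>(2j + 1) x\<^sup>j\<close> over \<open>j\<close>, for each of the two
  tails. It is dominated by twice the derivative of the geometric series.
\<close>

lemma ising_second_moment_le:
  assumes fin: "finite (verts T)" and p: "0 \<le> p" "p \<le> 1"
    and x: "0 \<le> x" "x < 1" and K: "0 \<le> K"
    and upper: "\<And>j::nat. ising_expectation T p (\<lambda>a. of_bool (real j < f a)) \<le> K * x ^ j"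
    and lower: "\<And>j::nat. ising_expectation T p (\<lambda>a. of_bool (real j < - f a)) \<le> K * x ^ j"
  shows "ising_expectation T p (\<lambda>a. (f a)\<^sup>2) \<le> 4 * K / (1 - x)\<^sup>2"
proof -
  let ?E = "ising_expectation T p" and ?\<Omega> = "verts T \<rightarrow>\<^sub>E {0, 1::nat}"
  have fin\<Omega>: "finite ?\<Omega>" using fin by (simp add: finite_PiE)
  \<comment> \<open>A bound for the function, so that the layer-cake sum is finite.\<close>
  define N where "N = nat \<lceil>Max ((\<lambda>a. \<bar>f a\<bar>) ` ?\<Omega>)\<rceil>"
  have N: "\<bar>f a\<bar> \<le> real N" if "a \<in> ?\<Omega>" for a
  proof -
    have "\<bar>f a\<bar> \<le> Max ((\<lambda>a. \<bar>f a\<bar>) ` ?\<Omega>)" using fin\<Omega> that by (intro Max_ge) auto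
    then show ?thesis unfolding N_def by linarith
  qed
  have "?E (\<lambda>a. (f a)\<^sup>2) \<le>
      ?E (\<lambda>a. \<Sum>j<N. (2 * real j + 1) * (of_bool (real j < f a) + of_bool (real j < - f a)))"
  proof (rule ising_mean_mono[OF p])
    fix a assume "a \<in> ?\<Omega>"
    then have "(f a)\<^sup>2 \<le> (\<Sum>j<N. (2 * real j + 1) * of_bool (real j < \<bar>f a\<bar>))"
      using square_le_tail_sum[of "\<bar>f a\<bar>" N] N by simp
    also have "\<dots> \<le> (\<Sum>j<N. (2 * real j + 1) *
        (of_bool (real j < f a) + of_bool (real j < - f a)))"
      by (intro sum_mono mult_left_mono) auto
    finally show "(f a)\<^sup>2 \<le> (\<Sum>j<N. (2 * real j + 1) *
        (of_bool (real j < f a) + of_bool (real j < - f a)))" .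
  qed
  also have "\<dots> = (\<Sum>j<N. (2 * real j + 1) *
      (?E (\<lambda>a. of_bool (real j < f a)) + ?E (\<lambda>a. of_bool (real j < - f a))))"
    by (simp only: ising_mean_sum ising_mean_cmult ising_mean_add)
  also have "\<dots> \<le> (\<Sum>j<N. (2 * real (Suc j)) * (K * x ^ j + K * x ^ j))"
    using K x by (intro sum_mono order_trans[OF mult_left_mono mult_right_mono] add_mono
        upper lower) auto
  also have "\<dots> = 4 * K * (\<Sum>j<N. real (Suc j) * x ^ j)"
    unfolding sum_distrib_left by (intro sum.cong) (auto simp: algebra_simps)
  also have "\<dots> \<le> 4 * K * (1 / (1 - x)\<^sup>2)"
  proof (intro mult_left_mono)
    have sums: "(\<lambda>j. real (Suc j) * x ^ j) sums (1 / (1 - x)\<^sup>2)"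
      using geometric_deriv_sums[of x] x by simp
    then show "(\<Sum>j<N. real (Suc j) * x ^ j) \<le> 1 / (1 - x)\<^sup>2"
      using x sum_le_suminf[of "\<lambda>j. real (Suc j) * x ^ j" "{..<N}"]
      by (simp add: sums_iff)
  qed (use K in auto)
  finally show ?thesis by simp
qed

text \<open>
  Two spins differ by at most \<open>2\<close>, which the factor \<open>1 / 2\<close> compensates.
\<close>

lemma magnetisation_lipschitz:
  assumes "finite V" "x \<in> V \<rightarrow>\<^sub>E {0, 1}" "y \<in> V \<rightarrow>\<^sub>E {0, 1}"
  shows "\<bar>(\<Sum>v\<in>V. 1 / (2 * real (card V)) * spin (x v)) - (\<Sum>v\<in>V. 1 / (2 * real (card V)) * spin (y v))\<bar>
    \<le> hamming_dist V x y"
proof -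
  have "\<bar>\<Sum>v\<in>V. spin (x v) - spin (y v)\<bar> \<le> (\<Sum>v\<in>V. 2 * of_bool (x v \<noteq> y v))"
  proof (rule order_trans[OF sum_abs sum_mono])
    fix v assume "v \<in> V"
    then have "x v \<in> {0, 1}" "y v \<in> {0, 1}" using assms by (auto simp: PiE_iff)
    then show "\<bar>spin (x v) - spin (y v)\<bar> \<le> 2 * of_bool (x v \<noteq> y v)" by (auto simp: spin_def)
  qed
  also have "\<dots> = 2 * real (card {v \<in> V. x v \<noteq> y v})"
    using assms(1) by (simp add: sum_distrib_left [symmetric] Int_def)
  finally have "1 / (2 * real (card V)) * \<bar>\<Sum>v\<in>V. spin (x v) - spin (y v)\<bar>
      \<le> 1 / (2 * real (card V)) * (2 * real (card {v \<in> V. x v \<noteq> y v}))"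
    by (intro mult_left_mono) auto
  then show ?thesis
    by (simp add: hamming_dist_def sum_divide_distrib [symmetric] sum_subtractf diff_divide_distrib [symmetric])
qed

text \<open>
  The magnetisation is Lipschitz and centred. If it has subgaussian tails at scale \<open>1 / \<surd>n\<close>, its
  variance is of order \<open>1 / n\<close>; on the other hand the variance is at least a multiple of
  \<open>\<Delta>\<^sup>2 / n\<^sup>2\<close>. As \<open>p > 0\<close>, the factor \<open>1 - (1 - 2p)\<^sup>2\<close> does not vanish.
\<close>

lemma desc_gen_norm_le_of_tails:
  assumes T: "rooted_tree T" and fin: "finite (verts T)" and p: "0 < p" "p \<le> 1 / 2"
    and c: "0 < c1" "0 < c2" and tails: "subgaussian_tails T p c1 c2"
  shows "(desc_gen_norm T (1 - 2 * p))\<^sup>2 \<le>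
    16 * max 1 c1 / ((1 - exp (- c2))\<^sup>2 * (1 - (1 - 2 * p)\<^sup>2)) * real (card (verts T))"
proof -
  let ?E = "ising_expectation T p" and ?V = "verts T" and ?b = "1 - 2 * p"
  define n where "n = real (card ?V)"
  have "root_vertex T \<in> ?V" using T by (simp add: rooted_tree_def)
  then have n: "0 < n" using fin by (auto simp: n_def card_gt_0_iff)
  define f where "f = (\<lambda>a. \<Sum>v\<in>?V. 1 / (2 * n) * spin (a v))"
  define \<delta> where "\<delta> v = 1 / (2 * n) * desc_gen_fun T ?b v" for v
  have b: "0 \<le> ?b" "?b < 1" using p by auto
  then have b2: "0 < 1 - ?b\<^sup>2" by (simp add: power_less_one_iff)
  have rec: "\<delta> v = 1 / (2 * n) + ?b * sum \<delta> (tree_children T v)" if "v \<in> ?V" for v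
    unfolding \<delta>_def desc_gen_fun_recursion[OF T fin that, of ?b] sum_distrib_left [symmetric]
    by (simp only: distrib_left mult_1_right mult.left_commute)
  have p': "0 \<le> p" "p \<le> 1" using p by auto
  have moments: "?E f = 0" "(1 - ?b\<^sup>2) * (\<Sum>v\<in>?V. (\<delta> v)\<^sup>2) \<le> ?E (\<lambda>a. (f a)\<^sup>2)"
    using ising_linear_moments[OF parent_tree_verts[OF T fin] p' rec] by (auto simp: f_def)
  have lip: "\<bar>f x - f y\<bar> \<le> hamming_dist ?V x y"
    if "x \<in> ?V \<rightarrow>\<^sub>E {0, 1}" "y \<in> ?V \<rightarrow>\<^sub>E {0, 1}" for x y
    using magnetisation_lipschitz[OF fin that] by (simp add: f_def n_def)
  have tail: "?E (\<lambda>a. of_bool (real j < sqrt n * g a)) \<le> max 1 c1 * exp (- c2) ^ j"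
    if mean: "?E g = 0" and lip: "\<And>x y. x \<in> ?V \<rightarrow>\<^sub>E {0, 1} \<Longrightarrow> y \<in> ?V \<rightarrow>\<^sub>E {0, 1} \<Longrightarrow>
        \<bar>g x - g y\<bar> \<le> hamming_dist ?V x y" for g j
  proof (cases "j = 0")
    case True
    \<comment> \<open>The tail hypothesis says nothing about the threshold \<open>0\<close>; the maximum with \<open>1\<close> covers it.\<close>
    have "?E (\<lambda>a. of_bool (real j < sqrt n * g a)) \<le> ?E (\<lambda>_. 1)"
      by (intro ising_mean_mono p') auto
    also have "\<dots> = 1" by (rule ising_mean_const[OF parent_tree_verts[OF T fin]])
    finally show ?thesis using True by simp
  next
    case False
    define \<epsilon> where "\<epsilon> = real j / sqrt n"
    have \<epsilon>: "0 < \<epsilon>" using False n by (simp add: \<epsilon>_def)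
    have "?E (\<lambda>a. of_bool (real j < sqrt n * g a)) = ?E (\<lambda>a. of_bool (\<epsilon> < g a))"
      using n by (intro ising_mean_cong) (simp add: \<epsilon>_def field_simps)
    also have "\<dots> \<le> c1 * exp (- c2 * n * \<epsilon>\<^sup>2)"
      using tails[unfolded subgaussian_tails_def, rule_format, OF \<epsilon> lip mean]
        measure_ising_measure[OF fin p'] by (simp add: n_def)
    also have "- c2 * n * \<epsilon>\<^sup>2 = - c2 * (real j)\<^sup>2"
      using n by (simp add: \<epsilon>_def power_divide)
    also have "c1 * exp (- c2 * (real j)\<^sup>2) \<le> max 1 c1 * exp (real j * - c2)"
    proof (intro mult_mono)
      have "real j \<le> (real j)\<^sup>2" using False by (simp add: power2_eq_square)
      then show "exp (- c2 * (real j)\<^sup>2) \<le> exp (real j * - c2)" using c by (simp add: mult.commute)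
    qed auto
    finally show ?thesis by (simp only: exp_of_nat_mult)
  qed
  have neg: "?E (\<lambda>a. - f a) = 0"
    using ising_mean_cmult[of "root_vertex T" "parent T" p ?V "-1" f] moments(1) by simp
  have "?E (\<lambda>a. (sqrt n * f a)\<^sup>2) \<le> 4 * max 1 c1 / (1 - exp (- c2))\<^sup>2"
  proof (rule ising_second_moment_le[OF fin p'])
    show "?E (\<lambda>a. of_bool (real j < sqrt n * f a)) \<le> max 1 c1 * exp (- c2) ^ j" for j
      by (rule tail[OF moments(1) lip])
    show "?E (\<lambda>a. of_bool (real j < - (sqrt n * f a))) \<le> max 1 c1 * exp (- c2) ^ j" for j
      using tail[of "\<lambda>a. - f a" j] neg lip by (simp add: abs_minus_commute)
  qed (use c in auto)
  then have "n * ?E (\<lambda>a. (f a)\<^sup>2) \<le> 4 * max 1 c1 / (1 - exp (- c2))\<^sup>2"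
    using n by (simp add: power_mult_distrib ising_mean_cmult)
  moreover have "n * ((1 - ?b\<^sup>2) * (\<Sum>v\<in>?V. (\<delta> v)\<^sup>2)) \<le> n * ?E (\<lambda>a. (f a)\<^sup>2)"
    using n by (intro mult_left_mono moments) auto
  moreover have eq: "(\<Sum>v\<in>?V. (\<delta> v)\<^sup>2) = (desc_gen_norm T ?b)\<^sup>2 / (4 * n\<^sup>2)"
    by (simp add: \<delta>_def desc_gen_norm_squared power_divide power_mult_distrib sum_divide_distrib)
  ultimately have "n * ((1 - ?b\<^sup>2) * ((desc_gen_norm T ?b)\<^sup>2 / (4 * n\<^sup>2)))
      \<le> 4 * max 1 c1 / (1 - exp (- c2))\<^sup>2" unfolding eq by (meson order_trans)
  moreover have "n * ((1 - ?b\<^sup>2) * ((desc_gen_norm T ?b)\<^sup>2 / (4 * n\<^sup>2))) =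
      (1 - ?b\<^sup>2) * (desc_gen_norm T ?b)\<^sup>2 / (4 * n)"
    using n by (simp add: power2_eq_square)
  ultimately have "(1 - ?b\<^sup>2) * (desc_gen_norm T ?b)\<^sup>2 / (4 * n)
      \<le> 4 * max 1 c1 / (1 - exp (- c2))\<^sup>2" by simp
  then have "(1 - ?b\<^sup>2) * (desc_gen_norm T ?b)\<^sup>2 \<le> 4 * max 1 c1 / (1 - exp (- c2))\<^sup>2 * (4 * n)"
    using n by (subst (asm) pos_divide_le_eq) auto
  then have "(desc_gen_norm T ?b)\<^sup>2 \<le> 4 * max 1 c1 / (1 - exp (- c2))\<^sup>2 * (4 * n) / (1 - ?b\<^sup>2)"
    using b2 by (subst pos_le_divide_eq) (auto simp: mult.commute)
  then show ?thesis by (simp add: n_def)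
qed

lemma ising_normal_levy_family_iff_tails:
  assumes T: "rooted_tree T" and inf: "infinite (verts T)" and lf: "locally_finite T"
    and p: "0 \<le> p" "p \<le> 1"
  shows "ising_normal_levy_family T p \<longleftrightarrow>
    (\<exists>c1>0. \<exists>c2>0. \<forall>k. subgaussian_tails (truncation T k) p c1 c2)"
proof -
  let ?T = "truncation T" and ?\<mu> = "\<lambda>k. ising_measure (truncation T k) p"
  interpret L: metric_prob_sequence "\<lambda>k. card (verts (?T k))"
    "\<lambda>k. hamming_dist (verts (?T k))" ?\<mu>
    by (rule ising_metric_prob_sequence[OF assms])
  have fin: "finite (verts (?T k))" for k by (rule finite_truncation[OF T lf])
  have int: "integrable (?\<mu> k) f" for k and f :: "_ \<Rightarrow> real"
    unfolding ising_measure_def using fin ising_mass_nonneg[OF p]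
    by (intro integrable_point_measure_finite) (auto intro!: finite_PiE)
  have lip: "f \<in> L.centred_lipschitz k \<longleftrightarrow>
      (\<forall>x\<in>verts (?T k) \<rightarrow>\<^sub>E {0, 1}. \<forall>y\<in>verts (?T k) \<rightarrow>\<^sub>E {0, 1}.
        \<bar>f x - f y\<bar> \<le> hamming_dist (verts (?T k)) x y) \<and> ising_expectation (?T k) p f = 0" for f k
    using int unfolding L.centred_lipschitz_def space_ising_measure integral_ising_measure[OF fin p]
    by blast
  have sup: "(SUP f\<in>L.centred_lipschitz k. measure (?\<mu> k) {x \<in> space (?\<mu> k). f x > \<epsilon>}) \<le> c \<longleftrightarrow>
      (\<forall>f\<in>L.centred_lipschitz k. measure (?\<mu> k) {x \<in> space (?\<mu> k). \<epsilon> < f x} \<le> c)" for k \<epsilon> c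
  proof (rule cSUP_le_iff)
    have "(\<lambda>_. 0) \<in> L.centred_lipschitz k"
      unfolding lip by (simp add: hamming_dist_def ising_mean_def)
    then show "L.centred_lipschitz k \<noteq> {}" by blast
    show "bdd_above ((\<lambda>f. measure (?\<mu> k) {x \<in> space (?\<mu> k). \<epsilon> < f x}) ` L.centred_lipschitz k)"
      using prob_space.prob_le_1[OF L.prob] by (intro bdd_aboveI2[where M = 1])
  qed
  have "(\<forall>\<epsilon>>0. \<forall>k. \<forall>f\<in>L.centred_lipschitz k. measure (?\<mu> k) {x \<in> space (?\<mu> k). \<epsilon> < f x}
        \<le> c1 * exp (- c2 * real (card (verts (?T k))) * \<epsilon>\<^sup>2)) \<longleftrightarrow>
      (\<forall>k. subgaussian_tails (?T k) p c1 c2)" for c1 c2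
    unfolding subgaussian_tails_def Ball_def [of "L.centred_lipschitz _"] lip imp_conjL by meson
  then show ?thesis unfolding L.normal_levy_family_def sup by simp
qed

theorem ising_normal_levy_family_iff:
  assumes T: "rooted_tree T" and inf: "infinite (verts T)" and lf: "locally_finite T"
    and p: "0 < p" "p \<le> 1 / 2"
  shows "ising_normal_levy_family T p \<longleftrightarrow>
    (\<exists>C. \<forall>k. (desc_gen_norm (truncation T k) (1 - 2 * p))\<^sup>2
       \<le> C * real (card (verts (truncation T k))))"
    (is "?levy \<longleftrightarrow> ?bound")
proof -
  have T': "rooted_tree (truncation T k)" for k by (rule rooted_tree_truncation[OF T])
  have fin: "finite (verts (truncation T k))" for k by (rule finite_truncation[OF T lf])
  have p': "0 \<le> p" "p \<le> 1" using p by auto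
  show ?thesis
  proof
    assume ?levy
    then obtain c1 c2 where c: "0 < c1" "0 < c2"
      and tails: "\<And>k. subgaussian_tails (truncation T k) p c1 c2"
      unfolding ising_normal_levy_family_iff_tails[OF T inf lf p'] by blast
    show ?bound using desc_gen_norm_le_of_tails[OF T' fin p c tails] by blast
  next
    assume ?bound
    then obtain C where C: "\<And>k. (desc_gen_norm (truncation T k) (1 - 2 * p))\<^sup>2
        \<le> C * real (card (verts (truncation T k)))" by blast
    have C': "(desc_gen_norm (truncation T k) (1 - 2 * p))\<^sup>2
        \<le> max 1 C * real (card (verts (truncation T k)))" for k
      by (rule order_trans[OF C mult_right_mono]) auto
    have "subgaussian_tails (truncation T k) p 1 (2 / max 1 C)" for k
      by (rule subgaussian_tails_of_norm_le[OF T' fin p'(1) p(2) _ C']) simp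
    moreover have "0 < 2 / max 1 C" by simp
    ultimately have "\<exists>c1>0. \<exists>c2>0. \<forall>k. subgaussian_tails (truncation T k) p c1 c2"
      using zero_less_one by blast
    then show ?levy unfolding ising_normal_levy_family_iff_tails[OF T inf lf p'] .
  qed
qed

section \<open>Growth of the tree\<close>

text \<open>
  A vertex of depth at least \<open>s - r\<close> has an ancestor whose generation \<open>s\<close> contains the generation
  \<open>r\<close> of the vertex. Only finitely many vertices have smaller depth. The detour via an ancestor is needed
  because generation \<open>r\<close> of a vertex may consist of many leaves, with no descendants at distance \<open>s\<close>.
\<close>

lemma card_descendants_at_le_of_later:
  assumes T: "rooted_tree T" and lf: "locally_finite T" and rs: "r \<le> s"
    and s: "\<And>v. v \<in> verts T \<Longrightarrow> card (descendants_at T s v) \<le> B"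
  shows "\<exists>B'. \<forall>v\<in>verts T. card (descendants_at T r v) \<le> B'"
proof (intro exI ballI)
  let ?V = "verts (truncation T (s - r))"
  have fin: "finite ?V" by (rule finite_truncation[OF T lf])
  fix v assume v: "v \<in> verts T"
  show "card (descendants_at T r v) \<le> B + (\<Sum>u\<in>?V. card (descendants_at T r u))"
  proof (cases "s - r \<le> depth T v")
    case True
    let ?u = "(parent T ^^ (s - r)) v"
    have "descendants_at T r v \<subseteq> descendants_at T s ?u"
    proof
      fix x assume "x \<in> descendants_at T r v"
      then have x: "x \<in> verts T" "r \<le> depth T x" "(parent T ^^ r) x = v"
        by (auto simp: descendants_at_eq[OF T])
      then have "depth T v = depth T x - r" using ancestor_depth(2)[OF T x(1,2)] by simp
      then have "s \<le> depth T x" using True rs x by simp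
      moreover have "(parent T ^^ s) x = ?u"
        using funpow_add[of "s - r" r "parent T"] rs x by simp
      ultimately show "x \<in> descendants_at T s ?u" using x by (simp add: descendants_at_eq[OF T])
    qed
    then have "card (descendants_at T r v) \<le> card (descendants_at T s ?u)"
      by (intro card_mono finite_descendants_at[OF T lf])
    also have "\<dots> \<le> B" by (intro s ancestor_depth(1)[OF T v True])
    finally show ?thesis by simp
  next
    case False
    then have "v \<in> ?V" using v by simp
    then have "card (descendants_at T r v) \<le> (\<Sum>u\<in>?V. card (descendants_at T r u))"
      using fin by (intro member_le_sum) auto
    then show ?thesis by simp
  qed
qed

text \<open>
  The limes superior controls only late generations; the early ones are controlled by a later one.
\<close>

lemma growth_bound_of_max_growth:
  assumes T: "rooted_tree T" and lf: "locally_finite T" and g: "max_growth T < ereal g"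
  obtains C where "0 < g" "0 \<le> C"
    "\<And>v r. v \<in> verts T \<Longrightarrow> real (card (descendants_at T r v)) \<le> C * g ^ r"
proof -
  let ?N = "\<lambda>r v. card (descendants_at T r v)"
  have "eventually (\<lambda>r. (SUP v\<in>verts T. ereal (real (?N r v) powr (1 / real r))) < ereal g) sequentially"
    using g unfolding max_growth_def by (rule Limsup_lessD)
  then obtain r0 where r0: "\<And>r. r0 \<le> r \<Longrightarrow>
      (SUP v\<in>verts T. ereal (real (?N r v) powr (1 / real r))) < ereal g"
    unfolding eventually_sequentially by blast
  have root_less: "real (?N r v) powr (1 / real r) < g" if "r0 \<le> r" "v \<in> verts T" for r v
  proof -
    have "ereal (real (?N r v) powr (1 / real r)) \<le>
        (SUP v\<in>verts T. ereal (real (?N r v) powr (1 / real r)))"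
      using that by (intro SUP_upper)
    also note r0[OF that(1)]
    finally show ?thesis by simp
  qed
  have "root_vertex T \<in> verts T" using T by (simp add: rooted_tree_def)
  from root_less[OF order_refl this] have g0: "0 < g" by (rule le_less_trans[rotated]) simp
  \<comment> \<open>The exponent \<open>1 / r\<close> is \<open>0\<close> for \<open>r = 0\<close>, so generation \<open>0\<close> counts as an early one.\<close>
  define s where "s = Suc r0"
  have large: "real (?N r v) \<le> g ^ r" if r: "s \<le> r" and v: "v \<in> verts T" for r v
  proof -
    have "r \<noteq> 0" using r by (simp add: s_def)
    then have "real (?N r v) = (real (?N r v) powr (1 / real r)) powr real r"
      by (simp add: powr_powr)
    also have "\<dots> \<le> g powr real r"
      using root_less[of r v] r v by (intro powr_mono2) (auto simp: s_def)
    finally show ?thesis using g0 by (simp add: powr_realpow)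
  qed
  have "\<exists>B. \<forall>v\<in>verts T. ?N r v \<le> B" for r
  proof (rule card_descendants_at_le_of_later[OF T lf])
    show "r \<le> max r s" by simp
    show "?N (max r s) v \<le> nat \<lfloor>g ^ max r s\<rfloor>" if "v \<in> verts T" for v
      using large[of "max r s" v] that by (simp add: le_nat_floor)
  qed
  then obtain B where B: "\<And>r v. v \<in> verts T \<Longrightarrow> ?N r v \<le> B r" by metis
  define C where "C = 1 + (\<Sum>r<s. real (B r) / g ^ r)"
  have C1: "1 \<le> C" using g0 by (auto simp: C_def intro!: sum_nonneg)
  have "real (?N r v) \<le> C * g ^ r" if v: "v \<in> verts T" for r v
  proof (cases "s \<le> r")
    case True
    have "real (?N r v) \<le> 1 * g ^ r" using large[OF True v] by simp
    also have "\<dots> \<le> C * g ^ r" using C1 g0 by (intro mult_right_mono) auto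
    finally show ?thesis .
  next
    case False
    have "real (?N r v) \<le> real (B r) / g ^ r * g ^ r" using B[OF v, of r] g0 by simp
    also have "\<dots> \<le> C * g ^ r"
    proof (intro mult_right_mono)
      have "real (B r) / g ^ r \<le> (\<Sum>r<s. real (B r) / g ^ r)"
        using False g0 by (intro member_le_sum) auto
      then show "real (B r) / g ^ r \<le> C" by (simp add: C_def)
    qed (use g0 in auto)
    finally show ?thesis .
  qed
  with g0 C1 show thesis by (intro that[of C]) auto
qed

lemma ereal_mult_le_1_iff:
  assumes "0 < c"
  shows "ereal c * x \<le> 1 \<longleftrightarrow> x \<le> ereal (1 / c)"
  using assms by (cases x) (auto simp: field_simps one_ereal_def)

lemma ereal_mult_less_1_iff:
  assumes "0 < c"
  shows "ereal c * x < 1 \<longleftrightarrow> x < ereal (1 / c)"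
  using assms by (cases x) (auto simp: field_simps one_ereal_def)

text \<open>
  The case \<open>b = 0\<close> is separate because there the growth may be infinite; only the term \<open>r = 0\<close>
  of the generating function remains.
\<close>

lemma desc_gen_norm_bounded_of_subcritical:
  assumes T: "rooted_tree T" and lf: "locally_finite T" and b: "0 \<le> b"
    and sub: "ereal (b\<^sup>2) * max_growth T < 1"
  obtains K where "\<And>k. (desc_gen_norm (truncation T k) b)\<^sup>2
    \<le> K * real (card (verts (truncation T k)))"
proof -
  obtain C q where C: "0 \<le> C" and q: "0 \<le> q" "q < 1" and
    growth: "\<And>v r. v \<in> verts T \<Longrightarrow> real (card (descendants_at T r v)) * (b\<^sup>2) ^ r \<le> C * q ^ r"
  proof (cases "b = 0")
    case True
    have "real (card (descendants_at T r v)) * (b\<^sup>2) ^ r \<le> 1 * 0 ^ r" if "v \<in> verts T" for v r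
      using True descendants_at_0[OF T that] by (cases r) auto
    \<comment> \<open>With \<open>q = 0\<close> the right-hand side is \<open>C\<close> for \<open>r = 0\<close>, as \<open>0\<^sup>0 = 1\<close>, and zero otherwise.\<close>
    then show thesis using that[of 1 0] by simp
  next
    case False
    then have b2: "0 < b\<^sup>2" by simp
    then have "max_growth T < ereal (1 / b\<^sup>2)" using sub ereal_mult_less_1_iff by blast
    then obtain g where g: "max_growth T < ereal g" "g < 1 / b\<^sup>2"
      using ereal_dense2 by fastforce
    obtain C where C: "0 < g" "0 \<le> C"
      "\<And>v r. v \<in> verts T \<Longrightarrow> real (card (descendants_at T r v)) \<le> C * g ^ r"
      using growth_bound_of_max_growth[OF T lf g(1)] by blast
    have "real (card (descendants_at T r v)) * (b\<^sup>2) ^ r \<le> C * (g * b\<^sup>2) ^ r"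
      if "v \<in> verts T" for v r
    proof -
      have "real (card (descendants_at T r v)) * (b\<^sup>2) ^ r \<le> C * g ^ r * (b\<^sup>2) ^ r"
        using C(3)[OF that] by (intro mult_right_mono) auto
      then show ?thesis by (simp add: power_mult_distrib)
    qed
    moreover have "0 \<le> g * b\<^sup>2" "g * b\<^sup>2 < 1"
      using C g b2 by (auto simp: pos_less_divide_eq)
    ultimately show thesis using that C by blast
  qed
  define M where "M = sqrt C / (1 - sqrt q)"
  have "(desc_gen_norm (truncation T k) b)\<^sup>2 \<le> M\<^sup>2 * real (card (verts (truncation T k)))" for k
  proof -
    have "real (card (descendants_at (truncation T k) r v)) * (b\<^sup>2) ^ r \<le> C * q ^ r"
      if "v \<in> verts (truncation T k)" for v r
    proof -
      have "card (descendants_at (truncation T k) r v) \<le> card (descendants_at T r v)"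
        unfolding descendants_at_truncation[OF T]
        by (intro card_mono finite_descendants_at[OF T lf]) auto
      then have "real (card (descendants_at (truncation T k) r v)) * (b\<^sup>2) ^ r
          \<le> real (card (descendants_at T r v)) * (b\<^sup>2) ^ r"
        by (intro mult_right_mono) auto
      also have "\<dots> \<le> C * q ^ r" using that by (intro growth) auto
      finally show ?thesis .
    qed
    then have "desc_gen_norm (truncation T k) b \<le> M * sqrt (real (card (verts (truncation T k))))"
      unfolding M_def
      by (intro desc_gen_norm_le rooted_tree_truncation[OF T] finite_truncation[OF T lf] b q C)
    then have "(desc_gen_norm (truncation T k) b)\<^sup>2 \<le>
        (M * sqrt (real (card (verts (truncation T k)))))\<^sup>2"
      by (intro power_mono) (auto simp: desc_gen_norm_def sum_nonneg)
    then show ?thesis by (simp only: power_mult_distrib real_sqrt_pow2 of_nat_0_le_iff)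
  qed
  then show thesis using that by blast
qed

text \<open>
  From \<open>(b\<^sup>k n\<^sub>k)\<^sup>2 \<le> \<delta>(\<rho>)\<^sup>2 \<le> \<Delta>\<^sub>k\<^sup>2 \<le> C n\<^sub>k\<close> follows \<open>|D\<^sub>k(\<rho>)| \<le> n\<^sub>k \<le> C b\<^bsup>-2k\<^esup>\<close>, and the
  constant disappears in the \<open>k\<close>-th root.
\<close>

lemma upper_growth_le_of_desc_gen_norm_bounded:
  assumes T: "rooted_tree T" and lf: "locally_finite T" and b: "0 < b" "b \<le> 1"
    and bound: "\<And>k. (desc_gen_norm (truncation T k) b)\<^sup>2
      \<le> K * real (card (verts (truncation T k)))"
  shows "upper_growth T \<le> ereal (1 / b\<^sup>2)"
proof -
  let ?r = "root_vertex T"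
  define C where "C = max 1 K"
  have C: "0 < C" "K \<le> C" by (simp_all add: C_def)
  have level: "real (card (descendants_at T k ?r)) \<le> C * (1 / b\<^sup>2) ^ k" for k
  proof -
    let ?T = "truncation T k"
    define n where "n = real (card (verts ?T))"
    have T': "rooted_tree ?T" and fin: "finite (verts ?T)"
      by (rule rooted_tree_truncation[OF T], rule finite_truncation[OF T lf])
    have root: "?r \<in> verts ?T" using T' unfolding rooted_tree_def by simp
    then have n: "0 < n" using fin unfolding n_def by (auto simp only: of_nat_0_less_iff card_gt_0_iff)
    have "b ^ k * n \<le> desc_gen_fun ?T b ?r"
      using desc_gen_fun_root_ge[OF T' fin _ b(2) depth_truncation[OF T]] b by (simp add: n_def)
    then have "(b ^ k * n)\<^sup>2 \<le> (desc_gen_fun ?T b ?r)\<^sup>2" using b n by (intro power_mono) auto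
    also have "\<dots> \<le> (desc_gen_norm ?T b)\<^sup>2"
      unfolding desc_gen_norm_squared using fin root
      by (intro member_le_sum[where f = "\<lambda>v. (desc_gen_fun ?T b v)\<^sup>2"]) auto
    also have "\<dots> \<le> C * n"
      using bound[of k] C n unfolding n_def by (meson mult_right_mono of_nat_0_le_iff order_trans)
    finally have "((b\<^sup>2) ^ k * n) * n \<le> C * n"
      by (simp add: power2_eq_square power_mult_distrib mult_ac)
    then have "(b\<^sup>2) ^ k * n \<le> C" using n by simp
    then have "n \<le> C * (1 / b\<^sup>2) ^ k" using b by (simp add: power_one_over field_simps)
    moreover have "descendants_at T k ?r \<subseteq> verts ?T"
    proof
      fix w assume w: "w \<in> descendants_at T k ?r"
      then have "w \<in> verts T" "graph_dist T ?r w = k" by (auto simp: descendants_at_def)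
      then show "w \<in> verts ?T" by simp
    qed
    then have "real (card (descendants_at T k ?r)) \<le> n"
      unfolding n_def using fin by (intro of_nat_mono card_mono)
    ultimately show ?thesis by linarith
  qed
  have "upper_growth T \<le> limsup (\<lambda>k. ereal (C powr (1 / real k) * (1 / b\<^sup>2)))"
    unfolding upper_growth_def
  proof (intro Limsup_mono eventually_sequentiallyI)
    fix k :: nat assume k: "1 \<le> k"
    have "real (card (descendants_at T k ?r)) powr (1 / real k)
        \<le> (C * (1 / b\<^sup>2) ^ k) powr (1 / real k)"
      by (intro powr_mono2 level) auto
    also have "\<dots> = C powr (1 / real k) * ((1 / b\<^sup>2) ^ k) powr (1 / real k)"
      using C b by (intro powr_mult)
    also have "((1 / b\<^sup>2) ^ k) powr (1 / real k) = 1 / b\<^sup>2"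
    proof -
      have "(1 / b\<^sup>2) ^ k = (1 / b\<^sup>2) powr real k" using b by (intro powr_realpow [symmetric]) auto
      then show ?thesis using b k by (simp only: powr_powr) simp
    qed
    finally show "ereal (real (card (descendants_at T k ?r)) powr (1 / real k))
        \<le> ereal (C powr (1 / real k) * (1 / b\<^sup>2))" by simp
  qed
  also have "\<dots> = ereal (1 / b\<^sup>2)"
  proof (rule lim_imp_Limsup)
    have "(\<lambda>k. C powr (1 / real k) * (1 / b\<^sup>2)) \<longlonglongrightarrow> C powr 0 * (1 / b\<^sup>2)"
      using C by (intro tendsto_intros lim_1_over_n) auto
    then show "(\<lambda>k. ereal (C powr (1 / real k) * (1 / b\<^sup>2))) \<longlonglongrightarrow> ereal (1 / b\<^sup>2)"
      using C by simp
  qed simp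
  finally show ?thesis .
qed

theorem theorem5:
  fixes T :: "'a rooted_graph" and p b :: real
  assumes "rooted_tree T" and "infinite (verts T)" and "locally_finite T"
    and "0 < p" and "p \<le> 1 / 2" and "b = 1 - 2 * p"
  shows
    "((\<lambda>k. desc_gen_norm (truncation T k) b) \<notin> O(\<lambda>k. sqrt (real (card (verts (truncation T k)))))
        \<longrightarrow> \<not> ising_normal_levy_family T p) \<and>
     (ereal (b\<^sup>2) * upper_growth T > 1 \<longrightarrow> \<not> ising_normal_levy_family T p) \<and>
     (max_growth T = upper_growth T \<longrightarrow>
        (ereal (b\<^sup>2) * upper_growth T < 1 \<longrightarrow> ising_normal_levy_family T p) \<and>
        (ereal (b\<^sup>2) * upper_growth T > 1 \<longrightarrow> \<not> ising_normal_levy_family T p))"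
proof -
  note T = assms(1) and lf = assms(3)
  have b: "0 \<le> b" "b \<le> 1" using assms by auto
  have levy_iff: "ising_normal_levy_family T p \<longleftrightarrow> (\<exists>C. \<forall>k. (desc_gen_norm (truncation T k) b)\<^sup>2
      \<le> C * real (card (verts (truncation T k))))"
    unfolding assms(6) by (rule ising_normal_levy_family_iff[OF assms(1-5)])
  have "(\<lambda>k. desc_gen_norm (truncation T k) b) \<in> O(\<lambda>k. sqrt (real (card (verts (truncation T k)))))"
    if levy: "ising_normal_levy_family T p"
  proof -
    obtain C where "\<forall>k. (desc_gen_norm (truncation T k) b)\<^sup>2
        \<le> C * real (card (verts (truncation T k)))"
      using levy unfolding levy_iff by blast
    note C = this[rule_format]
    have "norm (desc_gen_norm (truncation T k) b)
        \<le> sqrt C * norm (sqrt (real (card (verts (truncation T k)))))" for k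
      using real_sqrt_le_mono[OF C[of k]] by (simp add: real_sqrt_mult del: truncation_simps)
    then show ?thesis by (intro bigoI always_eventually) blast
  qed
  moreover have "\<not> ising_normal_levy_family T p" if super: "ereal (b\<^sup>2) * upper_growth T > 1"
  proof
    assume "ising_normal_levy_family T p"
    then obtain C where "\<forall>k. (desc_gen_norm (truncation T k) b)\<^sup>2
        \<le> C * real (card (verts (truncation T k)))"
      unfolding levy_iff by blast
    note C = this[rule_format]
    \<comment> \<open>By the convention \<open>0 * \<infinity> = 0\<close>, this also holds if the growth is infinite.\<close>
    have "b \<noteq> 0" using super by (auto simp: zero_ereal_def [symmetric])
    then have "0 < b" using b by simp
    from upper_growth_le_of_desc_gen_norm_bounded[OF T lf this b(2) C]
    have "ereal (b\<^sup>2) * upper_growth T \<le> 1" using \<open>0 < b\<close> by (subst ereal_mult_le_1_iff) auto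
    then show False using super by simp
  qed
  moreover have "ising_normal_levy_family T p"
    if "max_growth T = upper_growth T" "ereal (b\<^sup>2) * upper_growth T < 1"
    unfolding levy_iff using desc_gen_norm_bounded_of_subcritical[OF T lf b(1)] that by metis
  ultimately show ?thesis by blast
qed

end
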